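(* Let $j\in\mathbb{N}_0$. There is a unitary operator $\mathfrak{A}:F^2\to F^2_{(j+1)}$ with $W_z\mathfrak{A}=\mathfrak{A}W_z$ for all $z\in\mathbb{C}$ such that for every $f\in L^\infty(\mathbb{C})$ $$T_f^{(j)}=\mathfrak{A}^*\,T_{f,(j+1)}\,\mathfrak{A}.$$ In particular, the Toeplitz-type operator $T_f^{(j)}$ is unitarily equivalent to the Toeplitz operator $T_{f,(j+1)}$ with the same symbol $f$ on the true $(j+1)$-st polyanalytic Fock space.
   Context: $\mu$ is the Gaussian measure $d\mu(z)=\frac1\pi e^{-|z|^2}dz$ on $\mathbb{C}$, and $F^2=L^2(\mathbb{C},\mu)\cap\operatorname{Hol}(\mathbb{C})$ is the Fock space with inner product $\langle f,g\rangle=\int f\overline g\,d\mu$ and orthonormal basis $e_n(z)=z^n/\sqrt{n!}$, $n\in\mathbb{N}_0$. Put $k_z(w)=e^{w\overline z-|z|^2/2}$. For $z\in\mathbb{C}$ let $U_z$ be the bounded self-adjoint operator on $F^2$ given by $U_zf(w)=f(z-w)k_z(w)$. For $f\in L^\infty(\mathbb{C})$ and $j\in\mathbb{N}_0$ the Toeplitz-type operator $T_f^{(j)}$ is the bounded operator on $F^2$ defined weakly by $$\langle T_f^{(j)}g,h\rangle=\frac1\pi\int_{\mathbb{C}}f(z)\langle U_zg,e_j\rangle\langle e_j,U_zh\rangle\,dz,\qquad g,h\in F^2.$$ For $k\in\mathbb{N}=\{1,2,\dots\}$, $F_k^2$ is the closed subspace of $L^2(\mathbb{C},\mu)$ of all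 smooth functions $f\in L^2(\mathbb{C},\mu)$ with $\frac{\partial^k}{\partial\overline z^k}f=0$ (so $F_1^2=F^2$), with $F_0^2=\{0\}$; the true $k$-th polyanalytic Fock space is $F_{(k)}^2=F_k^2\ominus F_{k-1}^2$. The Weyl operators $W_zf(w)=k_z(w)f(w-z)$ are unitary on $L^2(\mathbb{C},\mu)$ and leave each $F_{(k)}^2$ invariant. With $P_{(k)}$ the orthogonal projection of $L^2(\mathbb{C},\mu)$ onto $F_{(k)}^2$, the Toeplitz operator on $F_{(k)}^2$ with symbol $f\in L^\infty(\mathbb{C})$ is $T_{f,(k)}g=P_{(k)}(fg)$. *)

theory Defs
  imports "HOL-Complex_Analysis.Complex_Analysis"
begin

text \<open>
  Elements of \<open>L\<^sup>2(\<complex>, \<mu>)\<close> are represented by functions, without passing to almost-everywhere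
  classes. All the closed subspaces below consist of continuous functions, and \<open>\<mu>\<close> has full
  support, so on them equality of functions is the same as equality in \<open>L\<^sup>2(\<complex>, \<mu>)\<close>; the
  descriptions by \<open>THE\<close> therefore denote functions, not merely classes.
\<close>

definition gaussian :: "complex measure" where
  "gaussian = density lebesgue (\<lambda>z. ennreal (exp (- (cmod z)\<^sup>2) / pi))"

definition L2 :: "(complex \<Rightarrow> complex) set" where
  "L2 = {f \<in> borel_measurable gaussian. integrable gaussian (\<lambda>z. (cmod (f z))\<^sup>2)}"

definition inner_L2 :: "(complex \<Rightarrow> complex) \<Rightarrow> (complex \<Rightarrow> complex) \<Rightarrow> complex" where
  "inner_L2 f g = (LINT z|gaussian. f z * cnj (g z))"

definition Linfty :: "(complex \<Rightarrow> complex) set" where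
  "Linfty = {f \<in> borel_measurable lebesgue. \<exists>C::real. AE z in lebesgue. cmod (f z) \<le> C}"

definition fock :: "(complex \<Rightarrow> complex) set" where
  "fock = {f \<in> L2. f holomorphic_on UNIV}"

definition fock_basis :: "nat \<Rightarrow> complex \<Rightarrow> complex" where
  "fock_basis n z = z ^ n / complex_of_real (sqrt (fact n))"

definition kern :: "complex \<Rightarrow> complex \<Rightarrow> complex" where
  "kern z w = exp (w * cnj z - complex_of_real ((cmod z)\<^sup>2 / 2))"

definition U_op :: "complex \<Rightarrow> (complex \<Rightarrow> complex) \<Rightarrow> complex \<Rightarrow> complex" where
  "U_op z f w = f (z - w) * kern z w"

definition weyl :: "complex \<Rightarrow> (complex \<Rightarrow> complex) \<Rightarrow> complex \<Rightarrow> complex" where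
  "weyl z f w = kern z w * f (w - z)"

definition toeplitz_type ::
  "nat \<Rightarrow> (complex \<Rightarrow> complex) \<Rightarrow> (complex \<Rightarrow> complex) \<Rightarrow> complex \<Rightarrow> complex" where
  "toeplitz_type j f g = (THE u. u \<in> fock \<and>
     (\<forall>h\<in>fock. inner_L2 u h =
        complex_of_real (1 / pi) *
        (LINT z|lebesgue. f z * inner_L2 (U_op z g) (fock_basis j)
                              * inner_L2 (fock_basis j) (U_op z h))))"

text \<open>Smoothness is meant in the real sense, for functions on \<open>\<real>\<^sup>2\<close>.\<close>

primrec Ck :: "nat \<Rightarrow> (complex \<Rightarrow> complex) \<Rightarrow> bool" where
  "Ck 0 f \<longleftrightarrow> continuous_on UNIV f"
| "Ck (Suc n) f \<longleftrightarrow> f differentiable_on UNIV \<and>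
     (\<forall>v. Ck n (\<lambda>z. frechet_derivative f (at z) v))"

definition smooth_fun :: "(complex \<Rightarrow> complex) \<Rightarrow> bool" where
  "smooth_fun f \<longleftrightarrow> (\<forall>n. Ck n f)"

text \<open>The conjugate Wirtinger derivative \<open>(\<partial>f/\<partial>x + \<i> \<partial>f/\<partial>y) / 2\<close>.\<close>

definition dbar :: "(complex \<Rightarrow> complex) \<Rightarrow> complex \<Rightarrow> complex" where
  "dbar f z = (frechet_derivative f (at z) 1 + \<i> * frechet_derivative f (at z) \<i>) / 2"

text \<open>For \<open>k = 0\<close> the condition reads \<open>f = 0\<close>, which gives the convention \<open>F\<^sub>0\<^sup>2 = {0}\<close>.\<close>

definition poly_fock :: "nat \<Rightarrow> (complex \<Rightarrow> complex) set" where
  "poly_fock k = {f \<in> L2. smooth_fun f \<and> (\<forall>z. (dbar ^^ k) f z = 0)}"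

text \<open>Meaningful for \<open>k \<ge> 1\<close> only.\<close>

definition true_poly_fock :: "nat \<Rightarrow> (complex \<Rightarrow> complex) set" where
  "true_poly_fock k = {f \<in> poly_fock k. \<forall>h\<in>poly_fock (k - 1). inner_L2 f h = 0}"

definition orth_proj ::
  "(complex \<Rightarrow> complex) set \<Rightarrow> (complex \<Rightarrow> complex) \<Rightarrow> complex \<Rightarrow> complex" where
  "orth_proj V g = (THE p. p \<in> V \<and> (\<forall>h\<in>V. inner_L2 (\<lambda>z. g z - p z) h = 0))"

definition toeplitz ::
  "nat \<Rightarrow> (complex \<Rightarrow> complex) \<Rightarrow> (complex \<Rightarrow> complex) \<Rightarrow> complex \<Rightarrow> complex" where
  "toeplitz k f g = orth_proj (true_poly_fock k) (\<lambda>z. f z * g z)"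

definition unitary_between :: "(complex \<Rightarrow> complex) set \<Rightarrow> (complex \<Rightarrow> complex) set \<Rightarrow>
    ((complex \<Rightarrow> complex) \<Rightarrow> complex \<Rightarrow> complex) \<Rightarrow> bool" where
  "unitary_between V W A \<longleftrightarrow>
     bij_betw A V W \<and>
     (\<forall>f\<in>V. \<forall>g\<in>V. \<forall>a b. A (\<lambda>z. a * f z + b * g z) = (\<lambda>z. a * A f z + b * A g z)) \<and>
     (\<forall>f\<in>V. \<forall>g\<in>V. inner_L2 (A f) (A g) = inner_L2 f g)"

text \<open>The Hilbert space adjoint of an operator with domain \<open>V\<close>, applied to \<open>h\<close>.\<close>

definition adj_op :: "(complex \<Rightarrow> complex) set \<Rightarrow>
    ((complex \<Rightarrow> complex) \<Rightarrow> complex \<Rightarrow> complex) \<Rightarrow> (complex \<Rightarrow> complex) \<Rightarrow> complex \<Rightarrow> complex" where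
  "adj_op V A h = (THE g. g \<in> V \<and> (\<forall>f\<in>V. inner_L2 (A f) h = inner_L2 f g))"

definition unitarily_equivalent :: "(complex \<Rightarrow> complex) set \<Rightarrow> (complex \<Rightarrow> complex) set \<Rightarrow>
    ((complex \<Rightarrow> complex) \<Rightarrow> complex \<Rightarrow> complex) \<Rightarrow>
    ((complex \<Rightarrow> complex) \<Rightarrow> complex \<Rightarrow> complex) \<Rightarrow> bool" where
  "unitarily_equivalent V W S T \<longleftrightarrow>
     (\<exists>A. unitary_between V W A \<and> (\<forall>g\<in>V. S g = adj_op V A (T (A g))))"

end

(*
  Put (A g)(z) = exp(|z|^2/2) <U_z g, e_j>. The weak definition of T_f^(j) then reads
  <T_f^(j) g, h> = <f A g, A h> in L^2(mu), so everything reduces to A being a unitary map onto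
  the true polyanalytic space; equivariance under the Weyl operators is a computation with kernels.
  Leibniz' rule identifies A with (zbar - d/dz)^j / sqrt(j!). The decisive formula: for
  F = psi_0 + zbar psi_1 + ... + zbar^j psi_j in L^2(mu) with entire psi_i,
    <F, A e_n> = sqrt(j! n!) [z^n] psi_j.
  It is obtained by integrating over discs, where monomials of different angular frequency are
  orthogonal, and letting the radius grow; an alternating binomial sum removes the terms i < j.
  It shows that the A e_n are orthonormal, that they are orthogonal to F_j^2, and that any F in
  F_{j+1}^2 orthogonal to all of them has psi_j = 0, hence lies in F_j^2.
*)
theory Submission
  imports Defs "HOL-Probability.Distributions"
begin

section \<open>The Gaussian measure and rotation invariance\<close>

text \<open>The terms zbar^i psi_i of F need not lie in L^2(mu) one by one, so integrating the
  product with A e_n termwise over the plane has no justification. Over a disc each term is bounded,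
  and only the full sum is carried to the limit. Orthogonality on discs needs nothing but rotation
  invariance, so no polar coordinates are set up. Operators and projections are \<open>THE\<close>
  values on sets of functions, so each of them needs an explicit witness. Witnesses are built from
  square-summable coefficients and pointwise convergent series; Fatou's lemma gives membership in
  L^2. That A g lies in L^2 is not visible from a formula containing derivatives of g. The way
  around: A e_n is a polynomial in z and zbar, hence in L^2; the decisive formula makes the A e_n
  orthonormal; and A g is the pointwise sum of the <g, e_n> A e_n, because for each fixed z the
  functions U_z e_n are orthonormal as well. The A e_n are the normalised complex Hermite
  polynomials of Ito.\<close>

lemma sets_gaussian [simp, measurable_cong]: "sets gaussian = sets lebesgue"
  by (simp add: gaussian_def)

lemma space_gaussian [simp]: "space gaussian = UNIV"
  by (simp add: gaussian_def)

lemma borel_measurable_gaussianI: "f \<in> borel_measurable borel \<Longrightarrow> f \<in> borel_measurable gaussian"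
  by (subst measurable_cong_sets[OF sets_gaussian refl]) (auto intro: measurable_completion)

lemma gaussian_density_measurable [measurable]:
  "(\<lambda>z. exp (- (cmod z)\<^sup>2) / pi) \<in> borel_measurable borel"
  by (intro borel_measurable_continuous_onI continuous_intros) auto

lemma gaussian_density_measurable_lebesgue [measurable]:
  "(\<lambda>z. exp (- (cmod z)\<^sup>2) / pi) \<in> borel_measurable lebesgue"
  by (rule measurable_completion) (use gaussian_density_measurable in simp)

lemma nn_integral_gaussian:
  assumes [measurable]: "f \<in> borel_measurable borel"
  shows "(\<integral>\<^sup>+z. f z \<partial>gaussian) = (\<integral>\<^sup>+z. ennreal (exp (- (cmod z)\<^sup>2) / pi) * f z \<partial>lborel)"
proof -
  have [measurable]: "f \<in> borel_measurable lebesgue"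
    by (rule measurable_completion) simp
  show ?thesis
    unfolding gaussian_def by (subst nn_integral_density) (auto simp: nn_integral_completion)
qed

lemma integral_gaussian:
  fixes f :: "complex \<Rightarrow> 'a :: {banach, second_countable_topology}"
  assumes "f \<in> borel_measurable lebesgue"
  shows "(LINT z|gaussian. f z) = (LINT z|lebesgue. (exp (- (cmod z)\<^sup>2) / pi) *\<^sub>R f z)"
  unfolding gaussian_def
by (rule integral_density) (use assms gaussian_density_measurable_lebesgue in simp_all)

section \<open>Radial integrals and Gaussian moments\<close>

text \<open>The preimage of a half-line below t > 0 is a disc of area pi t, and half-lines generate
  the Borel sets. This replaces polar coordinates for radial integrands.\<close>

lemma distr_cmod_sq:
  "distr lborel borel (\<lambda>z. (cmod z)\<^sup>2) = density lborel (\<lambda>t. ennreal pi * indicator {0..} t)"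
  (is "?M = ?N")
proof (rule measure_eqI_generator_eq)
  let ?E = "range lessThan :: real set set"
  have em: "emeasure ?M {..<t} = ennreal pi * emeasure lborel {0..<t}" for t :: real
  proof -
    have "(\<lambda>z::complex. (cmod z)\<^sup>2) -` {..<t} = (if t \<le> 0 then {} else ball 0 (sqrt t))"
    proof (cases "t \<le> 0")
      case True
      then have "\<not> (cmod z)\<^sup>2 < t" for z :: complex
        using order_trans[OF True zero_le_power2] by (simp add: not_less)
      with True show ?thesis by auto
    next
      case False
      then show ?thesis by (auto simp: real_less_rsqrt) (metis real_sqrt_less_iff real_sqrt_abs abs_norm_cancel)
    qed
    then show ?thesis
      by (auto simp: emeasure_distr emeasure_ball unit_ball_vol_2 ennreal_mult)
  qed
  show eq: "emeasure ?M X = emeasure ?N X" if "X \<in> ?E" for X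
  proof -
    from that obtain t where X: "X = {..<t}" by auto
    have "emeasure ?N {..<t} = (\<integral>\<^sup>+x. ennreal pi * indicator {0..<t} x \<partial>lborel)"
      by (subst emeasure_density) (auto intro!: nn_integral_cong simp: indicator_def)
    also have "\<dots> = ennreal pi * emeasure lborel {0..<t}"
      by (subst nn_integral_cmult_indicator) auto
    finally show ?thesis using em X by simp
  qed
  have "{..<s} \<inter> {..<t} = {..<min s t}" for s t :: real by auto
  then show "Int_stable ?E" by (auto simp: Int_stable_def)
  show "sets ?M = sigma_sets UNIV ?E" "sets ?N = sigma_sets UNIV ?E"
    by (simp_all add: borel_Iio)
  show "range (\<lambda>n::nat. {..<real n}) \<subseteq> ?E" by auto
  show "(\<Union>n::nat. {..<real n}) = UNIV" by (auto simp: reals_Archimedean2)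
  show "emeasure ?M {..<real n} \<noteq> \<infinity>" for n
    by (cases "n = 0") (auto simp: em ennreal_mult_eq_top_iff)
qed auto

text \<open>With t = |z|^2 the constant pi cancels and Euler's integral of t^k exp(-t) remains. The
  case k = 0 is the total mass one.\<close>

lemma nn_integral_gaussian_moment:
  "(\<integral>\<^sup>+z. ennreal ((cmod z) ^ (2 * k)) \<partial>gaussian) = ennreal (fact k)"
proof -
  have "(\<integral>\<^sup>+z. ennreal ((cmod z) ^ (2 * k)) \<partial>gaussian)
      = (\<integral>\<^sup>+z. ennreal (((cmod z)\<^sup>2) ^ k * exp (- (cmod z)\<^sup>2) / pi) \<partial>lborel)"
    by (subst nn_integral_gaussian) (auto intro!: nn_integral_cong simp: ennreal_mult[symmetric] power_mult[symmetric] mult_ac)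
  also have "\<dots> = (\<integral>\<^sup>+t. ennreal (t ^ k * exp (- t) / pi) \<partial>distr lborel borel (\<lambda>z. (cmod z)\<^sup>2))"
    by (subst nn_integral_distr) auto
  also have "\<dots> = (\<integral>\<^sup>+t. ennreal (t ^ k * exp (- t)) * indicator {0..} t \<partial>lborel)"
    unfolding distr_cmod_sq
    by (subst nn_integral_density) (auto intro!: nn_integral_cong simp: indicator_def ennreal_mult[symmetric])
  also have "\<dots> = ennreal (fact k)"
    by (subst nn_intergal_power_times_exp_Ici) simp
  finally show ?thesis .
qed

section \<open>Rotation invariance of Lebesgue measure on the plane\<close>

lemma lborel_complex_eq:
  "lborel = distr (lborel \<Otimes>\<^sub>M lborel) borel (\<lambda>p. Complex (fst p) (snd p))"
proof (rule lborel_eqI)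
  have meas [measurable]: "(\<lambda>p. Complex (fst p) (snd p)) \<in> borel_measurable (lborel \<Otimes>\<^sub>M lborel)"
    unfolding Complex_eq by measurable
  fix l u :: complex assume lu: "\<And>b. b \<in> Basis \<Longrightarrow> l \<bullet> b \<le> u \<bullet> b"
  have "(\<lambda>p. Complex (fst p) (snd p)) -` box l u = {Re l<..<Re u} \<times> {Im l<..<Im u}"
    by (auto simp: box_def Basis_complex_def)
  then show "emeasure (distr (lborel \<Otimes>\<^sub>M lborel) borel (\<lambda>p. Complex (fst p) (snd p))) (box l u)
      = (\<Prod>b\<in>Basis. (u - l) \<bullet> b)"
    using lu[of 1] lu[of \<i>]
    by (auto simp: emeasure_distr space_pair_measure lborel.emeasure_pair_measure_Times Basis_complex_def
        ennreal_mult[symmetric] complex_eq_iff)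
qed simp

text \<open>Both orders of integration are recorded because the two kinds of shear translate
  different coordinates.\<close>

lemma nn_integral_complex:
  assumes [measurable]: "f \<in> borel_measurable borel"
  shows "(\<integral>\<^sup>+z. f z \<partial>lborel) = (\<integral>\<^sup>+x. (\<integral>\<^sup>+y. f (Complex x y) \<partial>lborel) \<partial>lborel)"
    and "(\<integral>\<^sup>+z. f z \<partial>lborel) = (\<integral>\<^sup>+y. (\<integral>\<^sup>+x. f (Complex x y) \<partial>lborel) \<partial>lborel)"
proof -
  have meas [measurable]: "(\<lambda>p. Complex (fst p) (snd p)) \<in> borel_measurable (lborel \<Otimes>\<^sub>M lborel)"
    unfolding Complex_eq by measurable
  have *: "(\<integral>\<^sup>+z. f z \<partial>lborel) = (\<integral>\<^sup>+p. f (Complex (fst p) (snd p)) \<partial>(lborel \<Otimes>\<^sub>M lborel))"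
    by (subst lborel_complex_eq, subst nn_integral_distr) auto
  have m2: "(\<lambda>(x,y). f (Complex x y)) \<in> borel_measurable (lborel \<Otimes>\<^sub>M lborel)"
    using measurable_compose[OF meas assms] by (simp add: case_prod_unfold)
  show "(\<integral>\<^sup>+z. f z \<partial>lborel) = (\<integral>\<^sup>+x. (\<integral>\<^sup>+y. f (Complex x y) \<partial>lborel) \<partial>lborel)"
    using * lborel.nn_integral_fst[OF m2] by (simp add: case_prod_unfold)
  show "(\<integral>\<^sup>+z. f z \<partial>lborel) = (\<integral>\<^sup>+y. (\<integral>\<^sup>+x. f (Complex x y) \<partial>lborel) \<partial>lborel)"
    using * lborel_pair.nn_integral_snd[OF m2] by (simp add: case_prod_unfold)
qed

lemma nn_integral_shift_real:
  fixes c :: real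
  assumes [measurable]: "f \<in> borel_measurable borel"
  shows "(\<integral>\<^sup>+x. f (x + c) \<partial>lborel) = (\<integral>\<^sup>+x. f x \<partial>lborel)"
  using nn_integral_real_affine[OF assms, of 1 c] by (simp add: add.commute)

text \<open>Integrating over the real part first, the imaginary part is frozen and the shear is a
  translation of the line.\<close>

lemma nn_integral_shear_Re:
  fixes t :: real
  assumes [measurable]: "f \<in> borel_measurable borel"
  shows "(\<integral>\<^sup>+z. f (z + complex_of_real (t * Im z)) \<partial>lborel) = (\<integral>\<^sup>+z. f z \<partial>lborel)"
proof -
  have m: "(\<lambda>x. f (Complex x y)) \<in> borel_measurable borel" for y
    unfolding Complex_eq by measurable
  have "(\<integral>\<^sup>+z. f (z + complex_of_real (t * Im z)) \<partial>lborel)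
      = (\<integral>\<^sup>+y. (\<integral>\<^sup>+x. f (Complex (x + t * y) y) \<partial>lborel) \<partial>lborel)"
    by (subst nn_integral_complex(2), measurable) (simp add: Complex_eq algebra_simps)
  then show ?thesis
    by (simp add: nn_integral_shift_real[OF m] nn_integral_complex(2))
qed

lemma nn_integral_shear_Im:
  fixes t :: real
  assumes [measurable]: "f \<in> borel_measurable borel"
  shows "(\<integral>\<^sup>+z. f (z + \<i> * complex_of_real (t * Re z)) \<partial>lborel) = (\<integral>\<^sup>+z. f z \<partial>lborel)"
proof -
  have m: "(\<lambda>y. f (Complex x y)) \<in> borel_measurable borel" for x
    unfolding Complex_eq by measurable
  have "(\<integral>\<^sup>+z. f (z + \<i> * complex_of_real (t * Re z)) \<partial>lborel)
      = (\<integral>\<^sup>+x. (\<integral>\<^sup>+y. f (Complex x (y + t * x)) \<partial>lborel) \<partial>lborel)"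
    by (subst nn_integral_complex(1), measurable) (simp add: Complex_eq algebra_simps)
  then show ?thesis
    by (simp add: nn_integral_shift_real[OF m] nn_integral_complex(1))
qed

text \<open>A rotation by an angle outside \<open>\<pi>\<int>\<close> is a product of three shears.\<close>

lemma lborel_distr_rotation:
  assumes "cmod \<zeta> = 1" "Im \<zeta> \<noteq> 0"
  shows "distr lborel borel ((*) \<zeta>) = lborel"
proof (rule measure_eqI)
  fix A :: "complex set" assume "A \<in> sets (distr lborel borel ((*) \<zeta>))"
  then have [measurable]: "A \<in> sets borel" by simp
  \<comment> \<open>With \<zeta> = exp(i \<theta>) this \<open>t\<close> is -tan(\<theta>/2), the
    solution of 1 + t b = a. The matrix of \<open>?S\<close>, \<open>?R\<close>, \<open>?S\<close>
    in succession has both diagonal entries 1 + t b and off-diagonal entries 2t + t^2 b and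
    b.\<close>
  define a b t where "a = Re \<zeta>" "b = Im \<zeta>" "t = (a - 1) / b"
  have ab: "a\<^sup>2 + b\<^sup>2 = 1" and b: "b \<noteq> 0"
    using assms by (simp_all add: a_b_t_def cmod_def)
  let ?S = "\<lambda>z. z + complex_of_real (t * Im z)"
  let ?R = "\<lambda>z. z + \<i> * complex_of_real (b * Re z)"
  let ?f = "indicator A :: complex \<Rightarrow> ennreal"
  have tb: "t * b = a - 1" using b by (simp add: a_b_t_def)
  have tt: "2 * t + t * t * b = - b"
  proof -
    have "b * (2 * t + t * t * b) = 2 * (t * b) + (t * b) * (t * b)" by (simp add: algebra_simps)
    also have "\<dots> = b * (- b)" unfolding tb using ab by (simp add: power2_eq_square algebra_simps)
    finally show ?thesis using b using mult_left_cancel by blast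
  qed
  have rot: "?S (?R (?S z)) = \<zeta> * z" for z
  proof (rule complex_eqI)
    have "Re (?S (?R (?S z))) = Re z * (1 + t * b) + Im z * (2 * t + t * t * b)"
      by (simp add: algebra_simps)
    then show "Re (?S (?R (?S z))) = Re (\<zeta> * z)"
      unfolding tt tb by (simp add: a_b_t_def)
    have "Im (?S (?R (?S z))) = Im z * (1 + t * b) + b * Re z"
      by (simp add: algebra_simps)
    then show "Im (?S (?R (?S z))) = Im (\<zeta> * z)"
      unfolding tb by (simp add: a_b_t_def)
  qed
  have "emeasure (distr lborel borel ((*) \<zeta>)) A = (\<integral>\<^sup>+z. ?f (\<zeta> * z) \<partial>lborel)"
    by (simp add: nn_integral_distr flip: nn_integral_indicator)
  also have "\<dots> = (\<integral>\<^sup>+z. ?f (?S (?R (?S z))) \<partial>lborel)" by (simp only: rot)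
  also have "\<dots> = (\<integral>\<^sup>+z. ?f z \<partial>lborel)"
    by (subst nn_integral_shear_Re[of "\<lambda>z. ?f (?S (?R z))" t], measurable,
        subst nn_integral_shear_Im[of "\<lambda>z. ?f (?S z)" b], measurable,
        subst nn_integral_shear_Re[of ?f t], measurable)
  finally show "emeasure (distr lborel borel ((*) \<zeta>)) A = emeasure lborel A" by simp
qed simp

section \<open>The Hilbert space structure\<close>

lemma integrable_gaussian_moment: "integrable gaussian (\<lambda>z. (cmod z) ^ (2 * k))"
  and integral_gaussian_moment: "(LINT z|gaussian. (cmod z) ^ (2 * k)) = fact k"
proof -
  have m: "(\<lambda>z. (cmod z) ^ (2 * k)) \<in> borel_measurable gaussian"
    by (rule borel_measurable_gaussianI) measurable
  show "integrable gaussian (\<lambda>z. (cmod z) ^ (2 * k))"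
    by (rule integrableI_nonneg[OF m]) (auto simp: nn_integral_gaussian_moment)
  then show "(LINT z|gaussian. (cmod z) ^ (2 * k)) = fact k"
    by (simp add: integral_eq_nn_integral[OF m] nn_integral_gaussian_moment)
qed

interpretation gaussian: prob_space gaussian
  by standard (use nn_integral_gaussian_moment[of 0] in simp)

section \<open>Inner products and norms of square-integrable functions\<close>

definition norm2_L2 :: "(complex \<Rightarrow> complex) \<Rightarrow> real" where
  "norm2_L2 f = (LINT z|gaussian. (cmod (f z))\<^sup>2)"

lemma norm2_L2_nonneg [simp]: "0 \<le> norm2_L2 f"
  by (simp add: norm2_L2_def)

lemma inner_L2_self: "inner_L2 f f = complex_of_real (norm2_L2 f)"
  by (simp add: inner_L2_def norm2_L2_def complex_norm_square[symmetric] flip: of_real_power)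

lemma L2_D:
  assumes "f \<in> L2"
  shows "f \<in> borel_measurable gaussian" "integrable gaussian (\<lambda>z. (cmod (f z))\<^sup>2)"
  using assms by (auto simp: L2_def)

lemma nn_integral_L2: "f \<in> L2 \<Longrightarrow> (\<integral>\<^sup>+z. ennreal ((cmod (f z))\<^sup>2) \<partial>gaussian) = ennreal (norm2_L2 f)"
  unfolding norm2_L2_def by (rule nn_integral_eq_integral) (auto dest: L2_D)

text \<open>Meant for functions whose integrability is not yet known: a bound obtained from Fatou's
  lemma or from a change of variables yields membership and the norm estimate together.\<close>

lemma L2_nn_integralI:
  assumes "f \<in> borel_measurable gaussian" "(\<integral>\<^sup>+z. ennreal ((cmod (f z))\<^sup>2) \<partial>gaussian) \<le> ennreal C" "0 \<le> C"
  shows "f \<in> L2" "norm2_L2 f \<le> C"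
proof -
  have [measurable]: "f \<in> borel_measurable gaussian" by fact
  have "integrable gaussian (\<lambda>z. (cmod (f z))\<^sup>2)"
    using assms(2) by (intro integrableI_nonneg) (auto simp: le_less_trans)
  then show "f \<in> L2" using assms(1) by (simp add: L2_def)
  from nn_integral_L2[OF this] assms(2,3) show "norm2_L2 f \<le> C" by simp
qed

lemma L2_bounded_mult:
  assumes "g \<in> L2" "f \<in> borel_measurable gaussian" "AE z in gaussian. cmod (f z) \<le> C"
  shows "(\<lambda>z. f z * g z) \<in> L2"
proof -
  have [measurable]: "f \<in> borel_measurable gaussian" "g \<in> borel_measurable gaussian"
    using assms L2_D by auto
  have "integrable gaussian (\<lambda>z. C\<^sup>2 * (cmod (g z))\<^sup>2)" using L2_D[OF assms(1)] by simp
  then have "integrable gaussian (\<lambda>z. (cmod (f z * g z))\<^sup>2)"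
  proof (rule Bochner_Integration.integrable_bound)
    show "AE z in gaussian. norm ((cmod (f z * g z))\<^sup>2) \<le> norm (C\<^sup>2 * (cmod (g z))\<^sup>2)"
      using assms(3) by eventually_elim
        (auto simp: norm_mult power_mult_distrib intro!: mult_right_mono power_mono)
  qed simp
  then show ?thesis by (simp add: L2_def)
qed

lemma L2_add:
  assumes "f \<in> L2" "g \<in> L2" shows "(\<lambda>z. f z + g z) \<in> L2"
proof -
  have [measurable]: "f \<in> borel_measurable gaussian" "g \<in> borel_measurable gaussian"
    using assms L2_D by auto
  have "integrable gaussian (\<lambda>z. 2 * (cmod (f z))\<^sup>2 + 2 * (cmod (g z))\<^sup>2)"
    using L2_D assms by auto
  then have "integrable gaussian (\<lambda>z. (cmod (f z + g z))\<^sup>2)"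
  proof (rule Bochner_Integration.integrable_bound)
    have "(cmod (a + b))\<^sup>2 \<le> 2 * (cmod a)\<^sup>2 + 2 * (cmod b)\<^sup>2" for a b
    proof -
      have "(cmod (a + b))\<^sup>2 \<le> (cmod a + cmod b)\<^sup>2"
        by (intro power_mono norm_triangle_ineq) auto
      also have "\<dots> \<le> 2 * (cmod a)\<^sup>2 + 2 * (cmod b)\<^sup>2"
        using zero_le_power2[of "cmod a - cmod b"] by (simp add: power2_eq_square algebra_simps)
      finally show ?thesis .
    qed
    then show "AE z in gaussian. norm ((cmod (f z + g z))\<^sup>2) \<le> norm (2 * (cmod (f z))\<^sup>2 + 2 * (cmod (g z))\<^sup>2)"
      by auto
  qed simp
  then show ?thesis by (simp add: L2_def)
qed

lemma L2_cmult: "f \<in> L2 \<Longrightarrow> (\<lambda>z. c * f z) \<in> L2"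
  by (auto simp: L2_def norm_mult power_mult_distrib)

lemma L2_zero: "(\<lambda>z. 0) \<in> L2"
  by (simp add: L2_def)

lemma L2_diff: "f \<in> L2 \<Longrightarrow> g \<in> L2 \<Longrightarrow> (\<lambda>z. f z - g z) \<in> L2"
  using L2_add[of f "\<lambda>z. (-1) * g z"] L2_cmult[of g "-1"] by simp

lemma L2_sum: "(\<And>i. i \<in> I \<Longrightarrow> f i \<in> L2) \<Longrightarrow> (\<lambda>z. \<Sum>i\<in>I. f i z) \<in> L2"
  by (induction I rule: infinite_finite_induct) (auto intro: L2_zero L2_add)

lemma cnj_borel_measurable [measurable]: "cnj \<in> borel_measurable borel"
  by (intro borel_measurable_continuous_onI continuous_intros)

lemma L2_integrable_mult:
  assumes "f \<in> L2" "g \<in> L2"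
  shows "integrable gaussian (\<lambda>z. f z * cnj (g z))"
proof -
  have [measurable]: "f \<in> borel_measurable gaussian" "g \<in> borel_measurable gaussian"
    using assms L2_D by auto
  have "integrable gaussian (\<lambda>z. (cmod (f z))\<^sup>2 + (cmod (g z))\<^sup>2)"
    using L2_D assms by auto
  then show ?thesis
  proof (rule Bochner_Integration.integrable_bound)
    have "a * b \<le> a\<^sup>2 + b\<^sup>2" for a b :: real
      using zero_le_power2[of "a - b"] zero_le_power2[of "a + b"] by (simp add: power2_diff power2_sum)
    then show "AE z in gaussian. norm (f z * cnj (g z)) \<le> norm ((cmod (f z))\<^sup>2 + (cmod (g z))\<^sup>2)"
      by (auto simp: norm_mult)
  qed simp
qed

lemma inner_L2_cnj: "inner_L2 g f = cnj (inner_L2 f g)"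
  unfolding inner_L2_def Bochner_Integration.integral_cnj[symmetric]
  by (intro Bochner_Integration.integral_cong) (auto simp: mult.commute)

lemma inner_L2_add_left:
  "f \<in> L2 \<Longrightarrow> g \<in> L2 \<Longrightarrow> h \<in> L2 \<Longrightarrow> inner_L2 (\<lambda>z. f z + g z) h = inner_L2 f h + inner_L2 g h"
  by (simp add: inner_L2_def distrib_right L2_integrable_mult)

lemma inner_L2_diff_left:
  "f \<in> L2 \<Longrightarrow> g \<in> L2 \<Longrightarrow> h \<in> L2 \<Longrightarrow> inner_L2 (\<lambda>z. f z - g z) h = inner_L2 f h - inner_L2 g h"
  by (simp add: inner_L2_def left_diff_distrib L2_integrable_mult)

lemma inner_L2_cmult_left: "inner_L2 (\<lambda>z. c * f z) h = c * inner_L2 f h"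
  by (simp add: inner_L2_def mult.assoc)

lemma inner_L2_zero_left [simp]: "inner_L2 (\<lambda>z. 0) h = 0"
  by (simp add: inner_L2_def)

lemma inner_L2_diff_right:
  "f \<in> L2 \<Longrightarrow> g \<in> L2 \<Longrightarrow> h \<in> L2 \<Longrightarrow> inner_L2 h (\<lambda>z. f z - g z) = inner_L2 h f - inner_L2 h g"
  by (subst (1 2 3) inner_L2_cnj) (simp add: inner_L2_diff_left)

lemma inner_L2_cmult_right: "inner_L2 h (\<lambda>z. c * f z) = cnj c * inner_L2 h f"
  by (subst (1 2) inner_L2_cnj) (simp add: inner_L2_cmult_left)

lemma inner_L2_sum_left:
  "(\<And>i. i \<in> I \<Longrightarrow> f i \<in> L2) \<Longrightarrow> h \<in> L2 \<Longrightarrow> inner_L2 (\<lambda>z. \<Sum>i\<in>I. f i z) h = (\<Sum>i\<in>I. inner_L2 (f i) h)"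
  by (induction I rule: infinite_finite_induct) (auto simp: inner_L2_add_left L2_sum)

lemma inner_L2_sum_right:
  "(\<And>i. i \<in> I \<Longrightarrow> f i \<in> L2) \<Longrightarrow> h \<in> L2 \<Longrightarrow> inner_L2 h (\<lambda>z. \<Sum>i\<in>I. f i z) = (\<Sum>i\<in>I. inner_L2 h (f i))"
  by (subst (1 2) inner_L2_cnj) (simp add: inner_L2_sum_left)

lemma L2_Cauchy_Schwarz:
  assumes "f \<in> L2" "g \<in> L2"
  shows "(cmod (inner_L2 f g))\<^sup>2 \<le> norm2_L2 f * norm2_L2 g"
proof -
  have [measurable]: "f \<in> borel_measurable gaussian" "g \<in> borel_measurable gaussian"
    using assms L2_D by auto
  let ?I = "(LINT z|gaussian. cmod (f z) * cmod (g z))"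
  have int: "integrable gaussian (\<lambda>z. cmod (f z) * cmod (g z))"
    using integrable_norm[OF L2_integrable_mult[OF assms]] by (simp add: norm_mult)
  have "ennreal (?I\<^sup>2) = (\<integral>\<^sup>+z. ennreal (cmod (f z)) * ennreal (cmod (g z)) \<partial>gaussian)\<^sup>2"
    using nn_integral_eq_integral[OF int] by (simp add: ennreal_mult ennreal_power)
  also have "\<dots> \<le> (\<integral>\<^sup>+z. ennreal (cmod (f z)) ^ 2 \<partial>gaussian) * (\<integral>\<^sup>+z. ennreal (cmod (g z)) ^ 2 \<partial>gaussian)"
    by (rule Cauchy_Schwarz_nn_integral) auto
  also have "\<dots> = ennreal (norm2_L2 f * norm2_L2 g)"
    by (simp add: ennreal_power nn_integral_L2 assms ennreal_mult)
  finally have "?I\<^sup>2 \<le> norm2_L2 f * norm2_L2 g" by (simp add: ennreal_le_iff)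
  moreover have "cmod (inner_L2 f g) \<le> ?I"
    unfolding inner_L2_def by (rule order_trans[OF integral_norm_bound]) (simp add: norm_mult)
  then have "(cmod (inner_L2 f g))\<^sup>2 \<le> ?I\<^sup>2" by (intro power_mono) auto
  ultimately show ?thesis by linarith
qed

text \<open>The Gaussian density is positive, so the zero set has full Lebesgue measure; being
  closed, it is the whole plane. This passes from equality in L^2 to equality of functions.\<close>

lemma continuous_norm2_L2_eq_0:
  assumes "continuous_on UNIV f" "f \<in> L2" "norm2_L2 f = 0"
  shows "f z = 0"
proof -
  have [measurable]: "f \<in> borel_measurable gaussian" using assms L2_D by auto
  have "AE z in gaussian. (cmod (f z))\<^sup>2 = 0"
    using assms L2_D unfolding norm2_L2_def by (subst (asm) integral_nonneg_eq_0_iff_AE) auto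
  then have "AE z in lebesgue. f z = 0"
    unfolding gaussian_def by (subst (asm) AE_density) auto
  then have "AE z\<in>UNIV in lebesgue. z \<in> {z. f z = 0}" by simp
  moreover have "closed {z. f z = 0}"
    using continuous_closed_vimage[OF closed_singleton[of 0]] assms(1)
    by (simp add: closed_Collect_eq)
  ultimately show ?thesis using mem_closed_if_AE_lebesgue[of "{z. f z = 0}"] by auto
qed

section \<open>Orthonormal systems with pointwise convergent expansions\<close>

text \<open>Three systems instantiate this: the monomial basis, its image under the lift, and, for
  each fixed z, its image under \<open>U_op z\<close>.\<close>

locale orthonormal_L2 =
  fixes a :: "nat \<Rightarrow> complex \<Rightarrow> complex"
  assumes in_L2: "a n \<in> L2"
    and orthonormal: "inner_L2 (a m) (a n) = (if m = n then 1 else 0)"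
begin

lemma lincomb_in_L2: "(\<lambda>z. \<Sum>n\<in>I. c n * a n z) \<in> L2"
  by (intro L2_sum L2_cmult in_L2)

lemma inner_lincomb_right:
  "\<phi> \<in> L2 \<Longrightarrow> inner_L2 \<phi> (\<lambda>z. \<Sum>n\<in>I. c n * a n z) = (\<Sum>n\<in>I. cnj (c n) * inner_L2 \<phi> (a n))"
  by (subst inner_L2_sum_right) (auto intro: L2_cmult in_L2 simp: inner_L2_cmult_right)

lemma inner_lincomb_basis:
  "finite I \<Longrightarrow> inner_L2 (\<lambda>z. \<Sum>n\<in>I. c n * a n z) (a m) = (if m \<in> I then c m else 0)"
  by (subst inner_L2_sum_left) (auto intro: L2_cmult in_L2 simp: inner_L2_cmult_left orthonormal if_distrib[of "(*) _"] cong: if_cong)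

lemma norm2_lincomb:
  assumes "finite I"
  shows "norm2_L2 (\<lambda>z. \<Sum>n\<in>I. c n * a n z) = (\<Sum>n\<in>I. (cmod (c n))\<^sup>2)"
proof -
  have "complex_of_real (norm2_L2 (\<lambda>z. \<Sum>n\<in>I. c n * a n z)) = (\<Sum>n\<in>I. cnj (c n) * c n)"
    using assms by (simp add: inner_L2_self[symmetric] inner_lincomb_right[OF lincomb_in_L2] inner_lincomb_basis)
  also have "\<dots> = complex_of_real (\<Sum>n\<in>I. (cmod (c n))\<^sup>2)"
    by (simp add: complex_norm_square mult.commute del: of_real_power)
  finally show ?thesis by (simp only: of_real_eq_iff)
qed

lemma Bessel:
  assumes "\<phi> \<in> L2"
  shows "summable (\<lambda>n. (cmod (inner_L2 \<phi> (a n)))\<^sup>2)"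
proof (rule summableI_nonneg_bounded)
  fix N
  let ?c = "\<lambda>n. inner_L2 \<phi> (a n)"
  define p where "p = (\<lambda>z. \<Sum>n<N. ?c n * a n z)"
  have p: "p \<in> L2" unfolding p_def by (rule lincomb_in_L2)
  have 1: "inner_L2 \<phi> p = complex_of_real (\<Sum>n<N. (cmod (?c n))\<^sup>2)"
    unfolding p_def using assms
    by (simp add: inner_lincomb_right complex_norm_square mult.commute[of "cnj _"] del: of_real_power)
  have 2: "inner_L2 p p = complex_of_real (\<Sum>n<N. (cmod (?c n))\<^sup>2)"
    unfolding inner_L2_self p_def by (subst norm2_lincomb) auto
  have 3: "inner_L2 p \<phi> = inner_L2 \<phi> p"
    by (subst inner_L2_cnj) (simp add: 1)
  have "complex_of_real (norm2_L2 (\<lambda>z. \<phi> z - p z)) = complex_of_real (norm2_L2 \<phi> - (\<Sum>n<N. (cmod (?c n))\<^sup>2))"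
    using assms p
    by (simp add: inner_L2_self[symmetric] inner_L2_diff_left inner_L2_diff_right L2_diff 3 1 2)
  then have "norm2_L2 (\<lambda>z. \<phi> z - p z) = norm2_L2 \<phi> - (\<Sum>n<N. (cmod (?c n))\<^sup>2)"
    by (simp only: of_real_eq_iff)
  then show "(\<Sum>n<N. (cmod (?c n))\<^sup>2) \<le> norm2_L2 \<phi>"
    using norm2_L2_nonneg[of "\<lambda>z. \<phi> z - p z"] by linarith
qed simp

text \<open>The candidate sum \<open>S\<close> is given pointwise. Fatou's lemma bounds its squared
  distance to the N-th partial sum by the tail of the coefficient series, and Cauchy-Schwarz turns
  this into convergence of the inner products.\<close>

lemma Riesz_Fischer:
  assumes c: "summable (\<lambda>n. (cmod (c n))\<^sup>2)"
    and S: "\<And>z. (\<lambda>n. c n * a n z) sums S z"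
  shows "S \<in> L2"
    and "\<phi> \<in> L2 \<Longrightarrow> (\<lambda>n. cnj (c n) * inner_L2 \<phi> (a n)) sums inner_L2 \<phi> S"
proof -
  define p where "p N = (\<lambda>z. \<Sum>n<N. c n * a n z)" for N
  define \<tau> where "\<tau> N = (\<Sum>n. (cmod (c (n + N)))\<^sup>2)" for N
  have p: "p N \<in> L2" for N unfolding p_def by (rule lincomb_in_L2)
  have lim: "(\<lambda>N. p N z) \<longlonglongrightarrow> S z" for z using S by (simp add: p_def sums_def)
  have [measurable]: "p N \<in> borel_measurable gaussian" for N using p L2_D by auto
  have Sm [measurable]: "S \<in> borel_measurable gaussian"
    by (rule borel_measurable_LIMSEQ_metric[where f = p]) (auto simp: lim)
  have \<tau>0: "\<tau> N \<ge> 0" for N unfolding \<tau>_def using c by (intro suminf_nonneg) (auto simp: summable_iff_shift[of "\<lambda>n. (cmod (c n))\<^sup>2"])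
  have \<tau>: "\<tau> \<longlonglongrightarrow> 0"
    using suminf_exist_split2[OF c] unfolding \<tau>_def .
  have bound: "norm2_L2 (\<lambda>z. p M z - p N z) \<le> \<tau> N" if "N \<le> M" for M N
  proof -
    have "(\<lambda>z. p M z - p N z) = (\<lambda>z. \<Sum>n\<in>{N..<M}. c n * a n z)"
      using that by (auto simp: p_def lessThan_atLeast0 sum_diff_nat_ivl)
    then have "norm2_L2 (\<lambda>z. p M z - p N z) = (\<Sum>n\<in>{N..<M}. (cmod (c n))\<^sup>2)"
      by (simp add: norm2_lincomb)
    also have "\<dots> = (\<Sum>n<M-N. (cmod (c (n + N)))\<^sup>2)"
      using that sum.shift_bounds_nat_ivl[of "\<lambda>n. (cmod (c n))\<^sup>2" 0 N "M - N"]
      by (simp add: lessThan_atLeast0)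
    also have "\<dots> \<le> \<tau> N"
      unfolding \<tau>_def using c by (intro sum_le_suminf) (auto simp: summable_iff_shift[of "\<lambda>n. (cmod (c n))\<^sup>2"])
    finally show ?thesis .
  qed
  \<comment> \<open>Fatou in M for fixed N: by \<open>bound\<close>, the squared norms of
    \<open>p M - p N\<close> stay below \<open>\<tau> N\<close> once M is at least N.\<close>
  have tail: "(\<integral>\<^sup>+z. ennreal ((cmod (S z - p N z))\<^sup>2) \<partial>gaussian) \<le> ennreal (\<tau> N)" for N
  proof -
    have "(\<integral>\<^sup>+z. ennreal ((cmod (S z - p N z))\<^sup>2) \<partial>gaussian)
        = (\<integral>\<^sup>+z. liminf (\<lambda>M. ennreal ((cmod (p M z - p N z))\<^sup>2)) \<partial>gaussian)"
    proof (rule nn_integral_cong)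
      fix z
      have "(\<lambda>M. ennreal ((cmod (p M z - p N z))\<^sup>2)) \<longlonglongrightarrow> ennreal ((cmod (S z - p N z))\<^sup>2)"
        by (intro tendsto_intros lim)
      then show "ennreal ((cmod (S z - p N z))\<^sup>2) = liminf (\<lambda>M. ennreal ((cmod (p M z - p N z))\<^sup>2))"
        using lim_imp_Liminf by (metis sequentially_bot)
    qed
    also have "\<dots> \<le> liminf (\<lambda>M. \<integral>\<^sup>+z. ennreal ((cmod (p M z - p N z))\<^sup>2) \<partial>gaussian)"
      by (rule nn_integral_liminf) auto
    also have "\<dots> = liminf (\<lambda>M. ennreal (norm2_L2 (\<lambda>z. p M z - p N z)))"
      by (simp add: nn_integral_L2 L2_diff p)
    also have "\<dots> \<le> liminf (\<lambda>M. ennreal (\<tau> N))"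
      by (rule Liminf_mono) (auto simp: eventually_sequentially intro!: exI[of _ N] ennreal_leI bound)
    finally show ?thesis by (simp add: Liminf_const)
  qed
  have D: "(\<lambda>z. S z - p N z) \<in> L2" "norm2_L2 (\<lambda>z. S z - p N z) \<le> \<tau> N" for N
    using L2_nn_integralI[OF _ tail \<tau>0] by auto
  \<comment> \<open>The partial sum \<open>p 0\<close> is empty, so the error at N = 0 is
    \<open>S\<close> itself.\<close>
  show SL: "S \<in> L2" using D(1)[of 0] by (simp add: p_def)
  assume \<phi>: "\<phi> \<in> L2"
  have "(\<lambda>N. norm2_L2 \<phi> * \<tau> N) \<longlonglongrightarrow> 0" using tendsto_mult_right_zero[OF \<tau>] by simp
  moreover have "(cmod (inner_L2 \<phi> S - inner_L2 \<phi> (p N)))\<^sup>2 \<le> norm2_L2 \<phi> * \<tau> N" for N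
  proof -
    have "(cmod (inner_L2 \<phi> S - inner_L2 \<phi> (p N)))\<^sup>2 = (cmod (inner_L2 \<phi> (\<lambda>z. S z - p N z)))\<^sup>2"
      by (simp add: inner_L2_diff_right SL p \<phi>)
    also have "\<dots> \<le> norm2_L2 \<phi> * norm2_L2 (\<lambda>z. S z - p N z)"
      by (rule L2_Cauchy_Schwarz[OF \<phi> D(1)])
    also have "\<dots> \<le> norm2_L2 \<phi> * \<tau> N" by (intro mult_left_mono D) auto
    finally show ?thesis .
  qed
  ultimately have "(\<lambda>N. (cmod (inner_L2 \<phi> S - inner_L2 \<phi> (p N)))\<^sup>2) \<longlonglongrightarrow> 0"
    using Lim_null_comparison[of "\<lambda>N. (cmod (inner_L2 \<phi> S - inner_L2 \<phi> (p N)))\<^sup>2" "\<lambda>N. norm2_L2 \<phi> * \<tau> N" sequentially]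
    by simp
  from tendsto_real_sqrt[OF this] have "(\<lambda>N. cmod (inner_L2 \<phi> S - inner_L2 \<phi> (p N))) \<longlonglongrightarrow> 0"
    by simp
  then have "(\<lambda>N. inner_L2 \<phi> S - inner_L2 \<phi> (p N)) \<longlonglongrightarrow> 0"
    by (rule tendsto_norm_zero_cancel)
  then have "(\<lambda>N. inner_L2 \<phi> (p N)) \<longlonglongrightarrow> inner_L2 \<phi> S"
    using tendsto_diff[OF tendsto_const[of "inner_L2 \<phi> S"]] by fastforce
  then show "(\<lambda>n. cnj (c n) * inner_L2 \<phi> (a n)) sums inner_L2 \<phi> S"
    by (simp add: sums_def p_def inner_lincomb_right \<phi>)
qed

end

section \<open>Taylor coefficients and the Fock space\<close>

text \<open>Rotation by \<zeta> preserves disc, density and Lebesgue measure and multiplies the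
  monomial by \<zeta>^a conj(\<zeta>)^b. If this factor is not 1, the integral vanishes.\<close>

lemma disc_orthogonal:
  assumes "a \<noteq> b"
  shows "(LINT z|gaussian. indicator (ball 0 R) z *\<^sub>R (z ^ a * cnj z ^ b)) = 0"
proof -
  define h where "h z = (exp (- (cmod z)\<^sup>2) / pi) *\<^sub>R (indicator (ball 0 R) z *\<^sub>R (z ^ a * cnj z ^ b))" for z
  have [measurable]: "ball (0::complex) R \<in> sets borel" by simp
  have [measurable]: "(\<lambda>z. z ^ a * cnj z ^ b) \<in> borel_measurable borel"
    by (intro borel_measurable_continuous_onI continuous_intros)
  have [measurable]: "(\<lambda>z. indicator (ball 0 R) z *\<^sub>R (z ^ a * cnj z ^ b)) \<in> borel_measurable borel"
    by measurable
  have [measurable]: "h \<in> borel_measurable borel"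
    unfolding h_def by measurable
  have I: "(LINT z|gaussian. indicator (ball 0 R) z *\<^sub>R (z ^ a * cnj z ^ b)) = (LINT z|lborel. h z)"
    by (subst integral_gaussian) (auto simp: h_def[abs_def] integral_completion intro!: measurable_completion)
  \<comment> \<open>This angle makes the rotation factor equal to i or -i. It also lies in (0,
    pi/2], so \<zeta> is not real, as \<open>lborel_distr_rotation\<close> requires.\<close>
  define \<theta> where "\<theta> = pi / (2 * \<bar>real a - real b\<bar>)"
  define \<zeta> where "\<zeta> = cis \<theta>"
  define c where "c = \<zeta> ^ a * cnj \<zeta> ^ b"
  have d: "1 \<le> \<bar>real a - real b\<bar>" using assms by linarith
  have \<theta>: "0 < \<theta>" "\<theta> < pi" using d by (auto simp: \<theta>_def field_simps intro: less_le_trans[OF _ mult_left_mono])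
  have \<zeta>: "cmod \<zeta> = 1" "Im \<zeta> \<noteq> 0"
    using sin_gt_zero[OF \<theta>] by (simp_all add: \<zeta>_def)
  have "c = cis ((real a - real b) * \<theta>)"
    unfolding c_def \<zeta>_def cis_cnj Complex.DeMoivre cis_mult
    by (rule arg_cong[where f = cis]) (simp add: algebra_simps)
  also have "(real a - real b) * \<theta> = pi / 2 \<or> (real a - real b) * \<theta> = - (pi / 2)"
    using d by (cases "real a > real b") (auto simp: \<theta>_def field_simps)
  then have "cis ((real a - real b) * \<theta>) = cis (pi / 2) \<or> cis ((real a - real b) * \<theta>) = cis (- (pi / 2))"
    by (elim disjE) (simp_all only: simp_thms)
  then have "cis ((real a - real b) * \<theta>) \<noteq> 1"
    by (elim disjE) (simp_all only: complex_eq_iff cis.sel sin_pi_half sin_minus one_complex.sel, simp_all)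
  finally have c: "c \<noteq> 1" .
  have "(LINT z|lborel. h z) = (LINT z|distr lborel borel ((*) \<zeta>). h z)"
    by (simp add: lborel_distr_rotation[OF \<zeta>])
  also have "\<dots> = (LINT z|lborel. h (\<zeta> * z))"
    by (rule integral_distr) auto
  also have "\<dots> = (LINT z|lborel. c * h z)"
    using \<zeta> by (intro Bochner_Integration.integral_cong refl)
      (auto simp: h_def c_def norm_mult power_mult_distrib indicator_def)
  also have "\<dots> = c * (LINT z|lborel. h z)" by simp
  finally have "(1 - c) * (LINT z|lborel. h z) = 0" by (simp add: algebra_simps)
  with c I show ?thesis by simp
qed

text \<open>For R \<ge> 0 this is the lower incomplete Gamma integral of t^k exp(-t) up to R^2; what
  matters is its limit \<open>fact k\<close>.\<close>

definition disc_moment :: "real \<Rightarrow> nat \<Rightarrow> real" where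
  "disc_moment R k = (LINT z|gaussian. indicator (ball 0 R) z *\<^sub>R (cmod z) ^ (2 * k))"

lemma disc_limit:
  fixes H :: "complex \<Rightarrow> 'a :: {banach, second_countable_topology}"
  assumes "integrable gaussian H"
  shows "(\<lambda>n. LINT z|gaussian. indicator (ball 0 (real n)) z *\<^sub>R H z) \<longlonglongrightarrow> (LINT z|gaussian. H z)"
proof (rule integral_dominated_convergence[where w = "\<lambda>z. norm (H z)"])
  show [measurable]: "H \<in> borel_measurable gaussian" using assms by auto
  show "integrable gaussian (\<lambda>z. norm (H z))" using assms by auto
  show "(\<lambda>z. indicator (ball 0 (real n)) z *\<^sub>R H z) \<in> borel_measurable gaussian" for n
    by (intro borel_measurable_scaleR borel_measurable_indicator) auto
  show "AE z in gaussian. norm (indicator (ball 0 (real n)) z *\<^sub>R H z) \<le> norm (H z)" for n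
    by (auto simp: indicator_def)
  show "AE z in gaussian. (\<lambda>n. indicator (ball 0 (real n)) z *\<^sub>R H z) \<longlonglongrightarrow> H z"
  proof (rule AE_I2)
    fix z :: complex
    obtain N :: nat where N: "norm z < real N" using reals_Archimedean2 by blast
    have "eventually (\<lambda>n. indicator (ball 0 (real n)) z *\<^sub>R H z = H z) sequentially"
      using eventually_ge_at_top[of N] by eventually_elim (use N in auto)
    then show "(\<lambda>n. indicator (ball 0 (real n)) z *\<^sub>R H z) \<longlonglongrightarrow> H z"
      by (rule tendsto_eventually)
  qed
qed

lemma disc_moment_limit: "(\<lambda>n. disc_moment (real n) k) \<longlonglongrightarrow> fact k"
  using disc_limit[OF integrable_gaussian_moment] unfolding disc_moment_def integral_gaussian_moment by simp

lemma integrable_disc: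
  fixes H :: "complex \<Rightarrow> complex"
  assumes "continuous_on UNIV H"
  shows "integrable gaussian (\<lambda>z. indicator (ball 0 R) z *\<^sub>R H z)"
proof -
  have "compact (H ` cball 0 R)" using assms by (intro compact_continuous_image continuous_on_subset[OF assms]) auto
  then have "bounded (H ` cball 0 R)" by (rule compact_imp_bounded)
  then obtain C where "\<forall>x\<in>H ` cball 0 R. norm x \<le> C" unfolding bounded_iff ..
  then have C: "norm (indicator (ball 0 R) z *\<^sub>R H z) \<le> \<bar>C\<bar>" for z
    by (cases "z \<in> ball 0 R") (auto intro!: order_trans[OF _ abs_ge_self])
  have "integrable gaussian (\<lambda>z. C)" by simp
  then show ?thesis
  proof (rule Bochner_Integration.integrable_bound)
    show "(\<lambda>z. indicator (ball 0 R) z *\<^sub>R H z) \<in> borel_measurable gaussian"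
      using borel_measurable_continuous_onI[OF assms]
      by (intro borel_measurable_gaussianI borel_measurable_scaleR borel_measurable_indicator) auto
    show "AE z in gaussian. norm (indicator (ball 0 R) z *\<^sub>R H z) \<le> norm C"
      using C by simp
  qed
qed

section \<open>Taylor coefficients at the origin and their disc integrals\<close>

definition taylor_coeff :: "(complex \<Rightarrow> complex) \<Rightarrow> nat \<Rightarrow> complex" where
  "taylor_coeff f n = (deriv ^^ n) f 0 / fact n"

lemma taylor_sums:
  assumes "f holomorphic_on UNIV"
  shows "(\<lambda>n. taylor_coeff f n * z ^ n) sums f z"
  using holomorphic_power_series[of f 0 "norm z + 1" z] holomorphic_on_subset[OF assms]
  by (simp add: taylor_coeff_def)

lemma taylor_coeff_const: "taylor_coeff (\<lambda>z. c) n = (if n = 0 then c else 0)"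
  by (simp add: taylor_coeff_def)

lemma taylor_coeff_ident_mult:
  assumes "f holomorphic_on UNIV"
  shows "taylor_coeff (\<lambda>z. z * f z) n = (if n = 0 then 0 else taylor_coeff f (n - 1))"
proof (cases n)
  case 0
  then show ?thesis by (simp add: taylor_coeff_def)
next
  case (Suc m)
  have "(deriv ^^ n) (\<lambda>z. z * f z) 0
      = (\<Sum>i = 0..n. of_nat (n choose i) * (deriv ^^ i) (\<lambda>z. z) 0 * (deriv ^^ (n - i)) f 0)"
    by (rule higher_deriv_mult[OF _ assms, of "\<lambda>z. z"]) (auto intro: holomorphic_intros)
  \<comment> \<open>At the origin the identity has value 0, first derivative 1, and higher
    derivatives 0.\<close>
  also have "\<dots> = (\<Sum>i \<in> {1}. of_nat (n choose i) * (deriv ^^ i) (\<lambda>z. z) 0 * (deriv ^^ (n - i)) f 0)"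
    by (rule sum.mono_neutral_right) (auto simp: Suc higher_deriv_ident)
  also have "\<dots> = of_nat n * (deriv ^^ m) f 0"
    by (simp add: Suc)
  finally show ?thesis by (simp add: taylor_coeff_def Suc field_simps del: of_nat_Suc)
qed

lemma taylor_coeff_power_mult:
  assumes "f holomorphic_on UNIV"
  shows "taylor_coeff (\<lambda>z. z ^ j * f z) n = (if j \<le> n then taylor_coeff f (n - j) else 0)"
proof (induction j arbitrary: n)
  case (Suc j)
  have "(\<lambda>z. z ^ j * f z) holomorphic_on UNIV" using assms by (intro holomorphic_intros)
  from taylor_coeff_ident_mult[OF this, of n] Suc.IH[of "n - 1"] show ?case
    by (auto simp: mult.assoc)
qed simp

lemma taylor_coeff_eq_0:
  assumes "f holomorphic_on UNIV" "\<And>n. taylor_coeff f n = 0"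
  shows "f z = 0"
  using taylor_sums[OF assms(1), of z] assms(2) sums_unique2[OF _ sums_zero] by simp

text \<open>On a disc the Taylor series converges absolutely and uniformly, so it may be integrated
  term by term, and by \<open>disc_orthogonal\<close> only the term of degree b survives.\<close>

lemma disc_integral:
  assumes \<psi>: "\<psi> holomorphic_on UNIV"
  shows "(LINT z|gaussian. indicator (ball 0 R) z *\<^sub>R (\<psi> z * cnj z ^ b)) = taylor_coeff \<psi> b * disc_moment R b"
proof (cases "R > 0")
  case False
  then have "ball (0::complex) R = {}" by simp
  then show ?thesis by (simp add: disc_moment_def del: ball_eq_empty)
next
  case True
  let ?c = "taylor_coeff \<psi>"
  define f where "f n z = indicator (ball 0 R) z *\<^sub>R (?c n * z ^ n * cnj z ^ b)" for n z
  have bound: "norm (f n z) \<le> norm (?c n * of_real R ^ n) * R ^ b" for n z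
  proof (cases "z \<in> ball 0 R")
    case True
    then have "norm z \<le> R" by simp
    then have "norm (?c n) * norm z ^ n * norm z ^ b \<le> norm (?c n) * R ^ n * R ^ b"
      by (intro mult_mono power_mono mult_nonneg_nonneg) (use \<open>R > 0\<close> in auto)
    then show ?thesis using True \<open>R > 0\<close> by (simp add: f_def norm_mult norm_power)
  next
    case False
    then show ?thesis using \<open>R > 0\<close> by (simp add: f_def)
  qed
  \<comment> \<open>Convergence at the larger radius R + 1 gives absolute convergence at R.\<close>
  have "summable (\<lambda>n. ?c n * of_real (R + 1) ^ n)"
    using taylor_sums[OF \<psi>] sums_summable by blast
  then have "summable (\<lambda>n. norm (?c n * of_real R ^ n))"
    by (rule powser_insidea) (use True in auto)
  then have summ: "summable (\<lambda>n. norm (?c n * of_real R ^ n) * R ^ b)" by (rule summable_mult2)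
  have int: "integrable gaussian (f n)" for n
    unfolding f_def by (intro integrable_disc continuous_intros)
  have ib: "(LINT z|gaussian. norm (f n z)) \<le> norm (?c n * of_real R ^ n) * R ^ b" for n
    using Bochner_Integration.integral_mono[OF integrable_norm[OF int[of n]] gaussian.integrable_const bound[of n]]
      gaussian.prob_space by simp
  have "(\<lambda>n. LINT z|gaussian. f n z) sums (LINT z|gaussian. (\<Sum>n. f n z))"
  proof (rule sums_integral[OF int])
    show "AE z in gaussian. summable (\<lambda>n. norm (f n z))"
      by (intro AE_I2 summable_comparison_test'[OF summ]) (use bound in auto)
    show "summable (\<lambda>n. LINT z|gaussian. norm (f n z))"
      by (intro summable_comparison_test'[OF summ]) (use ib in auto)
  qed
  also have "(\<lambda>z. \<Sum>n. f n z) = (\<lambda>z. indicator (ball 0 R) z *\<^sub>R (\<psi> z * cnj z ^ b))"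
  proof
    fix z
    have "(\<lambda>n. f n z) sums (indicator (ball 0 R) z *\<^sub>R (\<psi> z * cnj z ^ b))"
      unfolding f_def by (intro sums_scaleR_right sums_mult2 taylor_sums \<psi>)
    then show "(\<Sum>n. f n z) = indicator (ball 0 R) z *\<^sub>R (\<psi> z * cnj z ^ b)" by (rule sums_unique[symmetric])
  qed
  finally have s1: "(\<lambda>n. LINT z|gaussian. f n z) sums (LINT z|gaussian. indicator (ball 0 R) z *\<^sub>R (\<psi> z * cnj z ^ b))" .
  have "(LINT z|gaussian. f n z) = (if n = b then ?c b * disc_moment R b else 0)" for n
  proof -
    have "(LINT z|gaussian. f n z) = ?c n * (LINT z|gaussian. indicator (ball 0 R) z *\<^sub>R (z ^ n * cnj z ^ b))"
      unfolding f_def integral_mult_right_zero[symmetric]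
      by (intro Bochner_Integration.integral_cong) (auto simp: indicator_def)
    moreover have "(LINT z|gaussian. indicator (ball 0 R) z *\<^sub>R (z ^ b * cnj z ^ b)) = of_real (disc_moment R b)"
      unfolding disc_moment_def integral_complex_of_real[symmetric]
    proof (intro Bochner_Integration.integral_cong refl)
      fix z
      have "z ^ b * cnj z ^ b = of_real (cmod z ^ (2 * b))"
        by (simp add: power_mult_distrib[symmetric] complex_norm_square[symmetric] power_mult)
      then show "indicator (ball 0 R) z *\<^sub>R (z ^ b * cnj z ^ b) = complex_of_real (indicator (ball 0 R) z *\<^sub>R cmod z ^ (2 * b))"
        by (simp add: scaleR_conv_of_real)
    qed
    ultimately show ?thesis using disc_orthogonal[of n b R] by auto
  qed
  then have "(\<lambda>n. LINT z|gaussian. f n z) sums (?c b * disc_moment R b)"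
    using sums_single[of b "\<lambda>n. ?c b * disc_moment R b"] by simp
  from sums_unique2[OF s1 this] show ?thesis .
qed

section \<open>The monomial basis of the Fock space\<close>

lemma power_in_L2: "(\<lambda>z. z ^ n) \<in> L2"
  unfolding L2_def using integrable_gaussian_moment[of n]
  by (auto simp: norm_power power_mult[symmetric] mult.commute intro!: borel_measurable_gaussianI)

lemma fock_basis_in_fock: "fock_basis n \<in> fock"
  unfolding fock_def fock_basis_def using L2_cmult[OF power_in_L2, of "1 / complex_of_real (sqrt (fact n))" n]
  by (auto intro!: holomorphic_intros)

lemma fock_D:
  assumes "g \<in> fock" shows "g \<in> L2" "g holomorphic_on UNIV"
  using assms by (auto simp: fock_def)

lemma inner_fock_basis:
  assumes "g \<in> fock"
  shows "inner_L2 g (fock_basis n) = complex_of_real (sqrt (fact n)) * taylor_coeff g n"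
proof -
  have int: "integrable gaussian (\<lambda>z. g z * cnj (z ^ n))"
    using fock_D[OF assms] power_in_L2 by (intro L2_integrable_mult)
  have "(\<lambda>k. taylor_coeff g n * disc_moment (real k) n) \<longlonglongrightarrow> (LINT z|gaussian. g z * cnj (z ^ n))"
    using disc_limit[OF int] by (simp add: disc_integral[OF fock_D(2)[OF assms]])
  moreover have "(\<lambda>k. taylor_coeff g n * disc_moment (real k) n) \<longlonglongrightarrow> taylor_coeff g n * complex_of_real (fact n)"
    by (intro tendsto_intros disc_moment_limit)
  ultimately have "inner_L2 g (\<lambda>z. z ^ n) = taylor_coeff g n * fact n"
    unfolding inner_L2_def using LIMSEQ_unique by fastforce
  then have "inner_L2 g (fock_basis n) = taylor_coeff g n * fact n / complex_of_real (sqrt (fact n))"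
    using inner_L2_cmult_right[of g "1 / complex_of_real (sqrt (fact n))" "\<lambda>z. z ^ n"]
    by (simp add: fock_basis_def[abs_def] mult.commute)
  moreover have "fact n = complex_of_real (sqrt (fact n)) * complex_of_real (sqrt (fact n))"
    by (simp flip: of_real_mult)
  ultimately have "inner_L2 g (fock_basis n) * complex_of_real (sqrt (fact n))
      = complex_of_real (sqrt (fact n)) * taylor_coeff g n * complex_of_real (sqrt (fact n))"
    by (simp add: mult_ac)
  then show ?thesis by simp
qed

text \<open>This is the Taylor series rewritten in the basis. It holds at every point, which is the
  form \<open>Riesz_Fischer\<close> takes as input.\<close>

lemma fock_expansion:
  assumes "g \<in> fock"
  shows "(\<lambda>n. inner_L2 g (fock_basis n) * fock_basis n z) sums g z"
  using taylor_sums[OF fock_D(2)[OF assms], of z]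
  by (simp add: inner_fock_basis[OF assms] fock_basis_def)

interpretation fock: orthonormal_L2 fock_basis
proof
  show "fock_basis n \<in> L2" for n using fock_basis_in_fock fock_D by blast
  have tc: "taylor_coeff (fock_basis m) n = (if m = n then 1 / complex_of_real (sqrt (fact n)) else 0)" for m n
    using taylor_coeff_power_mult[of "\<lambda>z. 1 / complex_of_real (sqrt (fact m))" m n]
    by (auto simp: fock_basis_def[abs_def] taylor_coeff_const)
  show "inner_L2 (fock_basis m) (fock_basis n) = (if m = n then 1 else 0)" for m n
    by (simp add: inner_fock_basis[OF fock_basis_in_fock] tc)
qed

section \<open>Polyanalytic functions\<close>

text \<open>Normal form that replaces smoothness together with the vanishing of the k-th dbar
  derivative; \<open>poly_fock_iff\<close> justifies the exchange. For k = 0 the empty sum forces f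
  = 0.\<close>

definition polyanalytic :: "nat \<Rightarrow> (complex \<Rightarrow> complex) \<Rightarrow> bool" where
  "polyanalytic k f \<longleftrightarrow> (\<exists>\<psi>. (\<forall>i. \<psi> i holomorphic_on UNIV) \<and> f = (\<lambda>z. \<Sum>i<k. cnj z ^ i * \<psi> i z))"

lemma polyanalytic_sum_has_derivative:
  assumes "\<And>i. \<psi> i holomorphic_on UNIV"
  shows "((\<lambda>z. \<Sum>i<k. cnj z ^ i * \<psi> i z) has_derivative
    (\<lambda>v. \<Sum>i<k. cnj z ^ i * (deriv (\<psi> i) z * v) + of_nat i * cnj v * cnj z ^ (i - 1) * \<psi> i z)) (at z)"
proof (rule has_derivative_sum)
  fix i
  have \<psi>: "(\<psi> i has_derivative (\<lambda>v. deriv (\<psi> i) z * v)) (at z)"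
    using holomorphic_derivI[OF assms open_UNIV, of z i] by (simp add: has_field_derivative_def)
  have c: "(cnj has_derivative cnj) (at z)"
    by (rule bounded_linear_imp_has_derivative[OF bounded_linear_cnj])
  show "((\<lambda>z. cnj z ^ i * \<psi> i z) has_derivative
      (\<lambda>v. cnj z ^ i * (deriv (\<psi> i) z * v) + of_nat i * cnj v * cnj z ^ (i - 1) * \<psi> i z)) (at z)"
    by (rule has_derivative_eq_rhs[OF has_derivative_mult[OF has_derivative_power[OF c] \<psi>]])
      (simp add: fun_eq_iff)
qed

text \<open>Filling the vacated top index with 0 keeps the sum at k terms, so that a directional
  derivative has the same shape as the function.\<close>

lemma sum_lower_shift:
  fixes X :: "nat \<Rightarrow> 'a :: comm_semiring_1"
  shows "(\<Sum>i<k. of_nat i * w ^ (i - 1) * X i) = (\<Sum>i<k. w ^ i * (if Suc i < k then of_nat (Suc i) * X (Suc i) else 0))"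
proof (cases k)
  case (Suc m)
  then show ?thesis
    by (subst Suc, subst sum.lessThan_Suc_shift) (simp add: mult_ac del: of_nat_Suc)
qed simp

lemma polyanalytic_sum_frechet:
  assumes "\<And>i. \<psi> i holomorphic_on UNIV"
  shows "frechet_derivative (\<lambda>z. \<Sum>i<k. cnj z ^ i * \<psi> i z) (at z) v =
    (\<Sum>i<k. cnj z ^ i * (v * deriv (\<psi> i) z + (if Suc i < k then of_nat (Suc i) * (cnj v * \<psi> (Suc i) z) else 0)))"
proof -
  have "frechet_derivative (\<lambda>z. \<Sum>i<k. cnj z ^ i * \<psi> i z) (at z) v
    = (\<Sum>i<k. cnj z ^ i * (deriv (\<psi> i) z * v) + of_nat i * cnj v * cnj z ^ (i - 1) * \<psi> i z)"
    by (subst frechet_derivative_at[OF polyanalytic_sum_has_derivative[of \<psi> k z, OF assms], symmetric]) (rule refl)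
  also have "\<dots> = (\<Sum>i<k. cnj z ^ i * (v * deriv (\<psi> i) z)) + (\<Sum>i<k. of_nat i * cnj z ^ (i - 1) * (cnj v * \<psi> i z))"
    unfolding sum.distrib[symmetric] by (intro sum.cong refl) (simp add: mult_ac)
  also have "(\<Sum>i<k. of_nat i * cnj z ^ (i - 1) * (cnj v * \<psi> i z))
      = (\<Sum>i<k. cnj z ^ i * (if Suc i < k then of_nat (Suc i) * (cnj v * \<psi> (Suc i) z) else 0))"
    by (rule sum_lower_shift)
  finally show ?thesis
    unfolding distrib_left sum.distrib .
qed

lemma polyanalytic_sum_differentiable:
  assumes "\<And>i. \<psi> i holomorphic_on UNIV"
  shows "(\<lambda>z. \<Sum>i<k. cnj z ^ i * \<psi> i z) differentiable_on UNIV"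
  unfolding differentiable_on_def differentiable_def
  using polyanalytic_sum_has_derivative[of \<psi> k, OF assms] by blast

text \<open>For fixed k the class is closed under directional derivatives, which is what the
  recursion defining \<open>Ck\<close> asks for.\<close>

lemma polyanalytic_Ck: "polyanalytic k f \<Longrightarrow> Ck n f"
proof (induction n arbitrary: f)
  case 0
  then obtain \<psi> where \<psi>: "\<And>i. \<psi> i holomorphic_on UNIV" and f: "f = (\<lambda>z. \<Sum>i<k. cnj z ^ i * \<psi> i z)"
    by (auto simp: polyanalytic_def)
  show ?case
    unfolding f using \<psi> by (auto intro!: continuous_intros holomorphic_on_imp_continuous_on[OF \<psi>])
next
  case (Suc n)
  then obtain \<psi> where \<psi>: "\<And>i. \<psi> i holomorphic_on UNIV" and f: "f = (\<lambda>z. \<Sum>i<k. cnj z ^ i * \<psi> i z)"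
    by (auto simp: polyanalytic_def)
  have "f differentiable_on UNIV"
    unfolding f by (rule polyanalytic_sum_differentiable[OF \<psi>])
  moreover
  have hol: "(\<lambda>z. v * deriv (\<psi> i) z + (if Suc i < k then of_nat (Suc i) * (cnj v * \<psi> (Suc i) z) else 0))
      holomorphic_on UNIV" for i v
    by (cases "Suc i < k") (auto intro!: holomorphic_intros holomorphic_deriv \<psi>)
  have "polyanalytic k (\<lambda>z. frechet_derivative f (at z) v)" for v
    unfolding polyanalytic_def f polyanalytic_sum_frechet[OF \<psi>]
    by (rule exI[of _ "\<lambda>i z. v * deriv (\<psi> i) z + (if Suc i < k then of_nat (Suc i) * (cnj v * \<psi> (Suc i) z) else 0)"])
      (use hol in auto)
  ultimately show ?case using Suc.IH by simp
qed

text \<open>In the directions 1 and i the derivatives of the entire factors cancel, since 1 + i^2 =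
  0, whereas those of the powers of zbar add up; one power is lost.\<close>

lemma dbar_polyanalytic_sum:
  assumes "\<And>i. \<psi> i holomorphic_on UNIV"
  shows "dbar (\<lambda>z. \<Sum>i<k. cnj z ^ i * \<psi> i z) = (\<lambda>z. \<Sum>i<k - 1. cnj z ^ i * (of_nat (Suc i) * \<psi> (Suc i) z))"
proof
  fix z
  have "dbar (\<lambda>z. \<Sum>i<k. cnj z ^ i * \<psi> i z) z = (\<Sum>i<k. cnj z ^ i * (if Suc i < k then of_nat (Suc i) * \<psi> (Suc i) z else 0))"
    unfolding dbar_def polyanalytic_sum_frechet[OF assms] sum_distrib_left sum.distrib[symmetric] sum_divide_distrib
    by (intro sum.cong) (auto simp: algebra_simps add_divide_distrib)
  also have "\<dots> = (\<Sum>i<k - 1. cnj z ^ i * (of_nat (Suc i) * \<psi> (Suc i) z))"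
    by (rule sum.mono_neutral_cong_right) auto
  finally show "dbar (\<lambda>z. \<Sum>i<k. cnj z ^ i * \<psi> i z) z = (\<Sum>i<k - 1. cnj z ^ i * (of_nat (Suc i) * \<psi> (Suc i) z))" .
qed

lemma polyanalytic_dbar_0: "polyanalytic k f \<Longrightarrow> (dbar ^^ k) f z = 0"
proof (induction k arbitrary: f)
  case 0
  then show ?case by (simp add: polyanalytic_def)
next
  case (Suc k)
  then obtain \<psi> where \<psi>: "\<And>i. \<psi> i holomorphic_on UNIV" and f: "f = (\<lambda>z. \<Sum>i<Suc k. cnj z ^ i * \<psi> i z)"
    by (auto simp: polyanalytic_def)
  have "polyanalytic k (dbar f)"
    unfolding f dbar_polyanalytic_sum[OF \<psi>] polyanalytic_def
    by (rule exI[of _ "\<lambda>i z. of_nat (Suc i) * \<psi> (Suc i) z"]) (auto intro!: holomorphic_intros \<psi>)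
  then show ?case using Suc.IH by (simp add: funpow_swap1)
qed

section \<open>From vanishing dbar derivatives to the polyanalytic normal form\<close>

lemma Ck_lincomb: "Ck n f \<Longrightarrow> Ck n g \<Longrightarrow> Ck n (\<lambda>z. a * f z + b * g z)"
proof (induction n arbitrary: f g)
  case 0
  then show ?case by (auto intro!: continuous_intros)
next
  case (Suc n)
  have d: "((\<lambda>z. a * f z + b * g z) has_derivative
      (\<lambda>v. a * frechet_derivative f (at z) v + b * frechet_derivative g (at z) v)) (at z)" for z
    using Suc.prems frechet_derivative_works[of _ "at z"]
    by (intro has_derivative_add has_derivative_mult_right) (auto simp: differentiable_on_def)
  have "frechet_derivative (\<lambda>z. a * f z + b * g z) (at z)
      = (\<lambda>v. a * frechet_derivative f (at z) v + b * frechet_derivative g (at z) v)" for z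
    using frechet_derivative_at[OF d] by simp
  moreover have "(\<lambda>z. a * f z + b * g z) differentiable_on UNIV"
    using d by (auto simp: differentiable_on_def differentiable_def)
  ultimately show ?case using Suc by simp
qed

lemma smooth_dbar:
  assumes "smooth_fun f" shows "smooth_fun (dbar f)"
proof -
  have "Ck n (dbar f)" for n
  proof -
    have "Ck (Suc n) f" using assms by (simp add: smooth_fun_def del: Ck.simps)
    then have "Ck n (\<lambda>z. (1/2) * frechet_derivative f (at z) 1 + (\<i>/2) * frechet_derivative f (at z) \<i>)"
      by (intro Ck_lincomb) auto
    then show ?thesis by (simp add: dbar_def[abs_def] add_divide_distrib)
  qed
  then show ?thesis by (simp add: smooth_fun_def)
qed

text \<open>The Cauchy-Riemann equation says that the real derivative commutes with multiplication
  by i, hence is multiplication by its value at 1.\<close>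

lemma holomorphic_if_dbar_0:
  assumes "f differentiable_on UNIV" "\<And>z. dbar f z = 0"
  shows "f holomorphic_on UNIV"
proof -
  have "(f has_field_derivative frechet_derivative f (at z) 1) (at z)" for z
  proof -
    let ?D = "frechet_derivative f (at z)"
    have D: "(f has_derivative ?D) (at z)"
      using assms(1) frechet_derivative_works by (auto simp: differentiable_on_def)
    then have lin: "linear ?D" by (rule has_derivative_linear)
    have "?D 1 + \<i> * ?D \<i> = 0" using assms(2)[of z] by (simp add: dbar_def)
    then have "\<i> * (?D 1 + \<i> * ?D \<i>) = 0" by simp
    then have i: "?D \<i> = \<i> * ?D 1" by (simp add: algebra_simps)
    have "?D v = ?D 1 * v" for v
    proof -
      have "?D v = ?D (Re v *\<^sub>R 1 + Im v *\<^sub>R \<i>)"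
        by (rule arg_cong[where f = ?D]) (simp add: complex_eq_iff)
      also have "\<dots> = Re v *\<^sub>R ?D 1 + Im v *\<^sub>R ?D \<i>"
        by (simp only: linear_add[OF lin] linear_scale[OF lin])
      also have "\<dots> = ?D 1 * (of_real (Re v) + \<i> * of_real (Im v))"
        unfolding i by (simp add: scaleR_conv_of_real algebra_simps)
      finally show ?thesis by (simp only: complex_eq[symmetric])
    qed
    then have "?D = (*) (?D 1)" by (rule ext)
    with D show ?thesis unfolding has_field_derivative_def by simp
  qed
  then show ?thesis by (auto simp: holomorphic_on_open)
qed

text \<open>By induction dbar f has the normal form. Integrating it formally in zbar gives G with
  the same dbar derivative, and f - G is then entire.\<close>

lemma dbar_0_polyanalytic:
  assumes "smooth_fun f" "\<And>z. (dbar ^^ k) f z = 0"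
  shows "polyanalytic k f"
  using assms
proof (induction k arbitrary: f)
  case 0
  then show ?case by (auto simp: polyanalytic_def intro!: exI[of _ "\<lambda>i z. 0"])
next
  case (Suc k)
  have "polyanalytic k (dbar f)"
    using Suc.prems by (intro Suc.IH smooth_dbar) (simp_all add: funpow_swap1)
  then obtain \<psi> where \<psi>: "\<And>i. \<psi> i holomorphic_on UNIV" and f: "dbar f = (\<lambda>z. \<Sum>i<k. cnj z ^ i * \<psi> i z)"
    by (auto simp: polyanalytic_def)
  \<comment> \<open>Antiderivative in zbar: zbar^(i-1) \<psi>_(i-1) becomes zbar^i \<psi>_(i-1) / i.
    Slot 0 is left empty and later receives f - G.\<close>
  define \<eta> where "\<eta> i z = (if i = 0 then 0 else \<psi> (i - 1) z / of_nat i)" for i z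
  have \<eta>: "\<eta> i holomorphic_on UNIV" for i
    unfolding \<eta>_def by (cases "i = 0") (auto intro!: holomorphic_intros \<psi>)
  define G where "G = (\<lambda>z. \<Sum>i<Suc k. cnj z ^ i * \<eta> i z)"
  have dG: "dbar G = dbar f"
    unfolding G_def dbar_polyanalytic_sum[OF \<eta>] f by (simp add: \<eta>_def del: of_nat_Suc)
  have dif: "f differentiable_on UNIV" using Suc.prems(1) Ck.simps(2)[of 0 f] by (simp add: smooth_fun_def del: Ck.simps)
  have difG: "G differentiable_on UNIV"
    unfolding G_def by (rule polyanalytic_sum_differentiable[OF \<eta>])
  have fr: "frechet_derivative (\<lambda>z. f z - G z) (at z) = (\<lambda>v. frechet_derivative f (at z) v - frechet_derivative G (at z) v)" for z
    using dif difG frechet_derivative_works[of _ "at z"]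
    by (intro frechet_derivative_at[symmetric] has_derivative_diff) (auto simp: differentiable_on_def)
  have "(\<lambda>z. f z - G z) holomorphic_on UNIV"
  proof (rule holomorphic_if_dbar_0)
    show "(\<lambda>z. f z - G z) differentiable_on UNIV" by (intro differentiable_on_diff dif difG)
    show "dbar (\<lambda>z. f z - G z) z = 0" for z
    proof -
      have "dbar (\<lambda>z. f z - G z) z = dbar f z - dbar G z"
        unfolding dbar_def fr by (simp add: algebra_simps diff_divide_distrib add_divide_distrib)
      then show ?thesis by (simp add: dG)
    qed
  qed
  then show ?case
    unfolding polyanalytic_def
    by (intro exI[of _ "\<lambda>i. if i = 0 then (\<lambda>z. f z - G z) else \<eta> i"])
      (use \<eta> in \<open>auto simp: G_def \<eta>_def sum.lessThan_Suc_shift fun_eq_iff simp del: sum.lessThan_Suc\<close>)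
qed

lemma poly_fock_iff: "f \<in> poly_fock k \<longleftrightarrow> f \<in> L2 \<and> polyanalytic k f"
  using polyanalytic_Ck polyanalytic_dbar_0 dbar_0_polyanalytic
  by (auto simp: poly_fock_def smooth_fun_def)

section \<open>The intertwining operator\<close>

lemma lborel_distr_reflect: "distr lborel borel (\<lambda>w. z - w) = (lborel :: complex measure)"
  using lborel_affine[of "-1" z] by (simp add: density_1)

lemma nn_integral_reflect:
  "F \<in> borel_measurable borel \<Longrightarrow> (\<integral>\<^sup>+w. F (z - w) \<partial>lborel) = (\<integral>\<^sup>+w. F w \<partial>(lborel :: complex measure))"
  by (subst lborel_distr_reflect[of z, symmetric], subst nn_integral_distr) auto

lemma integral_reflect:
  fixes F :: "complex \<Rightarrow> complex"
  shows "F \<in> borel_measurable borel \<Longrightarrow> (LINT w|lborel. F (z - w)) = (LINT w|lborel. F w)"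
  by (subst lborel_distr_reflect[of z, symmetric], subst integral_distr) auto

text \<open>Completing the square: the kernel carries the Gaussian weight at w to the one at z - w.
  With the reflection of Lebesgue measure this is why \<open>U_op z\<close> is isometric.\<close>

lemma norm_kern: "(cmod (kern z w))\<^sup>2 * exp (- (cmod w)\<^sup>2) = exp (- (cmod (z - w))\<^sup>2)"
proof -
  have "(cmod (kern z w))\<^sup>2 = exp (2 * Re (w * cnj z) - (cmod z)\<^sup>2)"
    by (simp add: kern_def power2_eq_square exp_add[symmetric])
  then have "(cmod (kern z w))\<^sup>2 * exp (- (cmod w)\<^sup>2) = exp (2 * Re (w * cnj z) - (cmod z)\<^sup>2 - (cmod w)\<^sup>2)"
    by (simp add: exp_add[symmetric])
  also have "2 * Re (w * cnj z) - (cmod z)\<^sup>2 - (cmod w)\<^sup>2 = - (cmod (z - w))\<^sup>2"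
    by (simp add: cmod_power2) (simp add: power2_eq_square algebra_simps)
  finally show ?thesis .
qed

lemma kern_holomorphic: "kern z holomorphic_on UNIV"
  unfolding kern_def[abs_def] by (intro holomorphic_intros)

lemma holomorphic_reflect:
  assumes "g holomorphic_on UNIV" shows "(\<lambda>w. g (z - w)) holomorphic_on UNIV"
proof -
  have "(\<lambda>w. z - w) holomorphic_on UNIV" by (intro holomorphic_intros)
  from holomorphic_on_compose_gen[OF this assms] show ?thesis by (simp add: o_def)
qed

lemma U_op_holomorphic:
  assumes "g holomorphic_on UNIV" shows "U_op z g holomorphic_on UNIV"
proof -
  show ?thesis
    unfolding U_op_def[abs_def] by (intro holomorphic_intros kern_holomorphic holomorphic_reflect assms)
qed

lemma holomorphic_measurable: "g holomorphic_on UNIV \<Longrightarrow> g \<in> borel_measurable borel"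
  by (intro borel_measurable_continuous_onI holomorphic_on_imp_continuous_on)

lemma U_op_fock:
  assumes "g \<in> fock"
  shows "U_op z g \<in> fock"
proof -
  note g = fock_D[OF assms]
  have [measurable]: "g \<in> borel_measurable borel" "U_op z g \<in> borel_measurable borel"
    using g U_op_holomorphic holomorphic_measurable by auto
  have "(\<integral>\<^sup>+w. ennreal ((cmod (U_op z g w))\<^sup>2) \<partial>gaussian)
      = (\<integral>\<^sup>+w. ennreal (exp (- (cmod (z - w))\<^sup>2) / pi) * ennreal ((cmod (g (z - w)))\<^sup>2) \<partial>lborel)"
    by (subst nn_integral_gaussian, measurable, intro nn_integral_cong)
      (simp add: ennreal_mult[symmetric] norm_kern[symmetric] U_op_def norm_mult power_mult_distrib mult_ac)
  also have "\<dots> = (\<integral>\<^sup>+w. ennreal (exp (- (cmod w)\<^sup>2) / pi) * ennreal ((cmod (g w))\<^sup>2) \<partial>lborel)"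
    by (rule nn_integral_reflect) measurable
  also have "\<dots> = ennreal (norm2_L2 g)"
    by (subst nn_integral_gaussian[symmetric]) (auto simp: nn_integral_L2[OF g(1)])
  finally have "(\<integral>\<^sup>+w. ennreal ((cmod (U_op z g w))\<^sup>2) \<partial>gaussian) = ennreal (norm2_L2 g)" .
  then have "U_op z g \<in> L2"
    by (intro L2_nn_integralI[of _ "norm2_L2 g"]) (auto intro: borel_measurable_gaussianI)
  then show ?thesis using g U_op_holomorphic by (auto simp: fock_def)
qed

lemma integral_gaussian_lborel:
  fixes f :: "complex \<Rightarrow> complex"
  assumes [measurable]: "f \<in> borel_measurable borel"
  shows "(LINT z|gaussian. f z) = (LINT z|lborel. (exp (- (cmod z)\<^sup>2) / pi) *\<^sub>R f z)"
  by (subst integral_gaussian) (auto intro!: integral_completion measurable_completion)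

lemma inner_U_op:
  assumes "g \<in> fock" "h \<in> fock"
  shows "inner_L2 (U_op z g) (U_op z h) = inner_L2 g h"
proof -
  have [measurable]: "g \<in> borel_measurable borel" "U_op z g \<in> borel_measurable borel"
    "h \<in> borel_measurable borel" "U_op z h \<in> borel_measurable borel"
    using fock_D[OF assms(1)] fock_D[OF assms(2)] U_op_holomorphic holomorphic_measurable by auto
  have "inner_L2 (U_op z g) (U_op z h)
      = (LINT w|lborel. (exp (- (cmod w)\<^sup>2) / pi) *\<^sub>R (U_op z g w * cnj (U_op z h w)))"
    unfolding inner_L2_def by (rule integral_gaussian_lborel) measurable
  also have "\<dots> = (LINT w|lborel. (exp (- (cmod (z - w))\<^sup>2) / pi) *\<^sub>R (g (z - w) * cnj (h (z - w))))"
    by (intro Bochner_Integration.integral_cong refl)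
      (simp add: norm_kern[symmetric] U_op_def scaleR_conv_of_real complex_norm_square mult_ac del: of_real_power)
  also have "\<dots> = (LINT w|lborel. (exp (- (cmod w)\<^sup>2) / pi) *\<^sub>R (g w * cnj (h w)))"
    by (rule integral_reflect) measurable
  also have "\<dots> = inner_L2 g h"
    unfolding inner_L2_def by (rule integral_gaussian_lborel[symmetric]) measurable
  finally show ?thesis .
qed

section \<open>The lift and its expansion in powers of zbar\<close>

text \<open>The operator A of the overview. On the Fock space it is the identity when j = 0, because
  the constant Taylor coefficient of U_z g is g(z) exp(-|z|^2/2).\<close>

definition polylift :: "nat \<Rightarrow> (complex \<Rightarrow> complex) \<Rightarrow> complex \<Rightarrow> complex" where
  "polylift j g z = exp (of_real ((cmod z)\<^sup>2 / 2)) * inner_L2 (U_op z g) (fock_basis j)"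

text \<open>The composite U_z W_v is a scalar multiple of U_(z-v), so both sides reduce to one inner
  product.\<close>

lemma polylift_weyl: "weyl v (polylift j g) = polylift j (weyl v g)"
proof
  fix z
  \<comment> \<open>This scalar is the phase exp(i Im(z conj v)), written so that the exponentials
    inside \<open>polylift\<close> cancel and \<open>kern v z\<close> remains.\<close>
  let ?c = "kern v z * exp (of_real ((cmod (z - v))\<^sup>2 / 2)) * exp (- of_real ((cmod z)\<^sup>2 / 2))"
  have "U_op z (weyl v g) = (\<lambda>w. ?c * U_op (z - v) g w)"
  proof
    fix w
    have "kern v (z - w) * kern z w = ?c * kern (z - v) w"
      unfolding kern_def exp_add[symmetric] by (rule arg_cong[where f = exp]) (simp add: algebra_simps)
    then show "U_op z (weyl v g) w = ?c * U_op (z - v) g w"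
      by (simp add: U_op_def weyl_def algebra_simps)
  qed
  then have "inner_L2 (U_op z (weyl v g)) (fock_basis j) = ?c * inner_L2 (U_op (z - v) g) (fock_basis j)"
    by (simp only: inner_L2_cmult_left)
  then show "weyl v (polylift j g) z = polylift j (weyl v g) z"
    by (simp add: weyl_def polylift_def exp_minus)
qed

lemma polylift_lincomb:
  assumes "f \<in> fock" "g \<in> fock"
  shows "polylift j (\<lambda>z. a * f z + b * g z) = (\<lambda>z. a * polylift j f z + b * polylift j g z)"
proof
  fix z
  have "U_op z (\<lambda>z. a * f z + b * g z) = (\<lambda>w. a * U_op z f w + b * U_op z g w)"
    by (auto simp: U_op_def algebra_simps)
  then show "polylift j (\<lambda>z. a * f z + b * g z) z = a * polylift j f z + b * polylift j g z"
    using assms by (simp add: polylift_def inner_L2_add_left L2_cmult fock_D U_op_fock fock_basis_in_fock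
        inner_L2_cmult_left algebra_simps)
qed

lemma higher_deriv_kern: "(deriv ^^ m) (kern z) = (\<lambda>w. cnj z ^ m * kern z w)"
proof (induction m)
  case (Suc m)
  have "((\<lambda>w. cnj z ^ m * kern z w) has_field_derivative cnj z ^ Suc m * kern z w) (at w)" for w
    unfolding kern_def by (auto intro!: derivative_eq_intros)
  then show ?case by (auto simp: Suc.IH intro!: DERIV_imp_deriv)
qed simp

definition lift_coeff :: "nat \<Rightarrow> (complex \<Rightarrow> complex) \<Rightarrow> nat \<Rightarrow> complex \<Rightarrow> complex" where
  "lift_coeff j g i z = of_nat (j choose i) * (-1) ^ (j - i) * (deriv ^^ (j - i)) g z / of_real (sqrt (fact j))"

text \<open>The inner product with e_j is, up to normalisation, the j-th derivative at w = 0 of g(z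
  - w) \<open>kern z w\<close>. Each derivative of the kernel yields a factor zbar, each derivative
  of g a sign, and the value of the kernel at 0 cancels the exponential in
  \<open>polylift\<close>.\<close>

lemma polylift_eq_sum:
  assumes "g \<in> fock"
  shows "polylift j g z = (\<Sum>i<Suc j. cnj z ^ i * lift_coeff j g i z)"
proof -
  note g = fock_D[OF assms]
  let ?e = "exp (- of_real ((cmod z)\<^sup>2 / 2)) :: complex"
  have hg: "(\<lambda>w. g ((-1) * w + z)) holomorphic_on UNIV"
    using holomorphic_reflect[OF g(2), of z] by simp
  have "(deriv ^^ j) (U_op z g) 0
      = (\<Sum>i = 0..j. of_nat (j choose i) * (deriv ^^ i) (\<lambda>w. g ((-1) * w + z)) 0 * (deriv ^^ (j - i)) (kern z) 0)"
    using higher_deriv_mult[OF hg kern_holomorphic[of z] open_UNIV UNIV_I, of j 0]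
    by (simp add: U_op_def[abs_def])
  also have "\<dots> = (\<Sum>i = 0..j. of_nat (j choose i) * ((-1) ^ i * (deriv ^^ i) g z) * (cnj z ^ (j - i) * ?e))"
    using higher_deriv_compose_linear'[OF g(2) open_UNIV open_UNIV UNIV_I, of "-1" z _ 0]
    by (simp add: higher_deriv_kern) (simp add: kern_def)
  \<comment> \<open>Reversal of the sum, so that the index counts powers of zbar instead of
    derivatives of g.\<close>
  also have "\<dots> = (\<Sum>i = 0..j. of_nat (j choose (j - i)) * ((-1) ^ (j - i) * (deriv ^^ (j - i)) g z) * (cnj z ^ (j - (j - i)) * ?e))"
    by (rule sum.reindex_bij_witness[of _ "\<lambda>i. j - i" "\<lambda>i. j - i"]) auto
  also have "\<dots> = (\<Sum>i<Suc j. cnj z ^ i * (of_nat (j choose i) * (-1) ^ (j - i) * (deriv ^^ (j - i)) g z)) * ?e"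
    unfolding sum_distrib_right
    by (intro sum.cong) (auto simp: binomial_symmetric[symmetric] mult_ac)
  finally have d: "(deriv ^^ j) (U_op z g) 0 = (\<Sum>i<Suc j. cnj z ^ i * (of_nat (j choose i) * (-1) ^ (j - i) * (deriv ^^ (j - i)) g z)) * ?e" .
  have s: "complex_of_real (sqrt (fact j)) / fact j = 1 / complex_of_real (sqrt (fact j))"
  proof -
    have "fact j = complex_of_real (sqrt (fact j)) * complex_of_real (sqrt (fact j))"
      by (simp flip: of_real_mult)
    then show ?thesis by (metis nonzero_divide_mult_cancel_left of_real_eq_0_iff real_sqrt_eq_zero_cancel_iff fact_nonzero)
  qed
  have "inner_L2 (U_op z g) (fock_basis j) = (deriv ^^ j) (U_op z g) 0 * (complex_of_real (sqrt (fact j)) / fact j)"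
    by (simp add: inner_fock_basis[OF U_op_fock[OF assms]] taylor_coeff_def)
  then show ?thesis
    unfolding polylift_def s d
    by (simp add: exp_minus lift_coeff_def sum_divide_distrib sum_distrib_right sum_distrib_left mult_ac del: sum.lessThan_Suc)
qed

lemma lift_coeff_holomorphic: "g \<in> fock \<Longrightarrow> lift_coeff j g i holomorphic_on UNIV"
  unfolding lift_coeff_def by (intro holomorphic_intros holomorphic_higher_deriv fock_D) auto

lemma lift_coeff_top: "lift_coeff j g j = (\<lambda>z. g z / of_real (sqrt (fact j)))"
  by (simp add: lift_coeff_def fun_eq_iff)

lemma polyanalytic_polylift: "g \<in> fock \<Longrightarrow> polyanalytic (Suc j) (polylift j g)"
  unfolding polyanalytic_def using polylift_eq_sum lift_coeff_holomorphic by blast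

lemma polyanalytic_continuous: "polyanalytic k f \<Longrightarrow> continuous_on UNIV f"
  using polyanalytic_Ck[of k f 0] by simp

text \<open>The left side is the j-th backward difference of N \<mapsto> (N choose i). By Pascal's
  rule each difference lowers N and i by one, and once i is used up the result is 0. The bound on j
  keeps the natural subtractions honest.\<close>

lemma alternating_binomial_sum:
  assumes "j \<le> N"
  shows "(\<Sum>k\<le>j. (-1) ^ k * of_nat ((j choose k) * ((N - k) choose i)) :: 'a :: comm_ring_1)
    = (if j \<le> i then of_nat ((N - j) choose (i - j)) else 0)"
  using assms
proof (induction j arbitrary: N)
  case (Suc j)
  let ?t = "\<lambda>j N k. (-1) ^ k * of_nat ((j choose k) * ((N - k) choose i)) :: 'a"
  have "(\<Sum>k\<le>Suc j. ?t (Suc j) N k) = ?t j N 0 + (\<Sum>k\<le>j. ?t (Suc j) N (Suc k))"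
    by (subst sum.atMost_Suc_shift) simp
  also have "(\<Sum>k\<le>j. ?t (Suc j) N (Suc k)) = (\<Sum>k\<le>j. ?t j N (Suc k)) - (\<Sum>k\<le>j. ?t j (N - 1) k)"
    unfolding sum_subtractf[symmetric] by (intro sum.cong refl) (simp add: algebra_simps)
  also have "?t j N 0 + ((\<Sum>k\<le>j. ?t j N (Suc k)) - (\<Sum>k\<le>j. ?t j (N - 1) k))
      = (\<Sum>k\<le>Suc j. ?t j N k) - (\<Sum>k\<le>j. ?t j (N - 1) k)"
  proof -
    have "(\<Sum>k\<le>Suc j. ?t j N k) = ?t j N 0 + (\<Sum>k\<le>j. ?t j N (Suc k))"
      by (rule sum.atMost_Suc_shift)
    then show ?thesis by (simp only: add_diff_eq)
  qed
  also have "(\<Sum>k\<le>Suc j. ?t j N k) = (\<Sum>k\<le>j. ?t j N k)" by (simp add: binomial_eq_0)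
  finally have "(\<Sum>k\<le>Suc j. ?t (Suc j) N k) = (\<Sum>k\<le>j. ?t j N k) - (\<Sum>k\<le>j. ?t j (N - 1) k)" .
  also have "\<dots> = (if j \<le> i then of_nat ((N - j) choose (i - j)) else 0)
      - (if j \<le> i then of_nat ((N - 1 - j) choose (i - j)) else 0)"
    using Suc.prems by (subst (1 2) Suc.IH) auto
  also have "\<dots> = (if Suc j \<le> i then of_nat ((N - Suc j) choose (i - Suc j)) else 0)"
  proof -
    obtain M where M: "N - j = Suc M" "N - Suc j = M" using Suc.prems by (metis Suc_diff_Suc Suc_le_lessD)
    \<comment> \<open>The cases are 0 - 0, then 1 - 1 when i = j, and Pascal's rule when i >
      j.\<close>
    consider "i < j" | "i = j" | l where "i - j = Suc l" "i - Suc j = l" "Suc j \<le> i"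
      by (metis Suc_diff_Suc Suc_leI linorder_neqE_nat)
    then show ?thesis using M by cases auto
  qed
  finally show ?case .
qed simp

section \<open>Unitarity\<close>

lemma higher_deriv_fock_basis:
  "(deriv ^^ k) (fock_basis n) =
    (\<lambda>z. (if k \<le> n then fact n / fact (n - k) else 0) * z ^ (n - k) / complex_of_real (sqrt (fact n)))"
proof (induction k)
  case 0
  then show ?case by (simp add: fock_basis_def[abs_def])
next
  case (Suc k)
  let ?C = "\<lambda>k. if k \<le> n then fact n / fact (n - k) else (0 :: complex)"
  have C: "?C k * of_nat (n - k) = ?C (Suc k)"
  proof (cases "k < n")
    case True
    then have "n - k = Suc (n - Suc k)" by simp
    then have "fact (n - k) = of_nat (n - k) * (fact (n - Suc k) :: complex)"
      by (metis fact_Suc of_nat_mult of_nat_fact)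
    with True show ?thesis by simp
  qed auto
  have "((\<lambda>z. ?C k * z ^ (n - k) / complex_of_real (sqrt (fact n))) has_field_derivative
      ?C (Suc k) * z ^ (n - Suc k) / complex_of_real (sqrt (fact n))) (at z)" for z
    unfolding C[symmetric] by (rule derivative_eq_intros refl | simp)+
  then show ?case by (auto simp: Suc.IH intro!: DERIV_imp_deriv)
qed

text \<open>Coefficients of Ito's complex Hermite polynomial divided by sqrt(j! n!). For k > n the
  value is 0, because z^(n - k) would then be read as z^0. Being real, the coefficients are
  untouched by conjugation.\<close>

definition lift_basis_coeff :: "nat \<Rightarrow> nat \<Rightarrow> nat \<Rightarrow> real" where
  "lift_basis_coeff j n k =
    (if k \<le> n then (-1) ^ k * real (j choose k) * fact n / fact (n - k) else 0) / (sqrt (fact j) * sqrt (fact n))"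

lemma polylift_basis:
  "polylift j (fock_basis n) z = (\<Sum>k\<le>j. of_real (lift_basis_coeff j n k) * (z ^ (n - k) * cnj z ^ (j - k)))"
proof -
  have "polylift j (fock_basis n) z = (\<Sum>i\<le>j. cnj z ^ i * lift_coeff j (fock_basis n) i z)"
    by (simp add: polylift_eq_sum[OF fock_basis_in_fock] lessThan_Suc_atMost del: sum.lessThan_Suc)
  also have "\<dots> = (\<Sum>k\<le>j. cnj z ^ (j - k) * lift_coeff j (fock_basis n) (j - k) z)"
    by (rule sum.reindex_bij_witness[of _ "\<lambda>i. j - i" "\<lambda>i. j - i"]) auto
  also have "\<dots> = (\<Sum>k\<le>j. of_real (lift_basis_coeff j n k) * (z ^ (n - k) * cnj z ^ (j - k)))"
    by (intro sum.cong refl)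
      (simp add: lift_coeff_def lift_basis_coeff_def higher_deriv_fock_basis binomial_symmetric[symmetric] mult_ac)
  finally show ?thesis .
qed

lemma monomial_in_L2: "(\<lambda>z. z ^ a * cnj z ^ b) \<in> L2"
  unfolding L2_def using integrable_gaussian_moment[of "a + b"]
  by (auto simp: norm_mult norm_power power_add[symmetric] power_mult[symmetric] mult.commute
      intro!: borel_measurable_gaussianI borel_measurable_continuous_onI continuous_intros)

lemma polylift_basis_in_L2: "polylift j (fock_basis n) \<in> L2"
  unfolding polylift_basis[abs_def] by (intro L2_sum L2_cmult monomial_in_L2)

text \<open>For every k the angular selection picks the same coefficient of \<psi>_i, of index n + i
  - j. The factorials left by the moments then form an alternating binomial sum over k, which
  vanishes unless i = j.\<close>

lemma inner_polylift_basis: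
  assumes \<psi>: "\<And>i. \<psi> i holomorphic_on UNIV" and F: "F = (\<lambda>z. \<Sum>i<Suc j. cnj z ^ i * \<psi> i z)" "F \<in> L2"
  shows "inner_L2 F (polylift j (fock_basis n))
    = complex_of_real (sqrt (fact j) * sqrt (fact n)) * taylor_coeff (\<psi> j) n"
proof -
  let ?a = "\<lambda>k. complex_of_real (lift_basis_coeff j n k)"
  \<comment> \<open>Conjugation turns zbar^(j-k) into z^(j-k), which is absorbed into the entire
    factor; all powers of zbar collect in the exponent n - k + i.\<close>
  let ?\<Psi> = "\<lambda>i k z. z ^ (j - k) * \<psi> i z"
  let ?t = "\<lambda>i k. ?a k * taylor_coeff (?\<Psi> i k) (n - k + i)"
  have hol: "?\<Psi> i k holomorphic_on UNIV" for i k by (intro holomorphic_intros \<psi>)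
  have prod: "F z * cnj (polylift j (fock_basis n) z)
      = (\<Sum>i<Suc j. \<Sum>k\<le>j. ?a k * (?\<Psi> i k z * cnj z ^ (n - k + i)))" for z
    unfolding F polylift_basis cnj_sum sum_product
    by (intro sum.cong refl) (simp add: power_add mult_ac)
  have disc: "(LINT z|gaussian. indicator (ball 0 R) z *\<^sub>R (F z * cnj (polylift j (fock_basis n) z)))
      = (\<Sum>i<Suc j. \<Sum>k\<le>j. ?t i k * disc_moment R (n - k + i))" for R
  proof -
    have int: "integrable gaussian (\<lambda>z. indicator (ball 0 R) z *\<^sub>R (?a k * (?\<Psi> i k z * cnj z ^ (n - k + i))))" for i k
      by (intro integrable_disc continuous_intros holomorphic_on_imp_continuous_on \<psi>)
    have "(LINT z|gaussian. indicator (ball 0 R) z *\<^sub>R (F z * cnj (polylift j (fock_basis n) z)))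
        = (\<Sum>i<Suc j. \<Sum>k\<le>j. LINT z|gaussian. indicator (ball 0 R) z *\<^sub>R (?a k * (?\<Psi> i k z * cnj z ^ (n - k + i))))"
      unfolding prod scaleR_sum_right
      by (simp only: Bochner_Integration.integral_sum Bochner_Integration.integrable_sum int)
    also have "\<dots> = (\<Sum>i<Suc j. \<Sum>k\<le>j. ?t i k * disc_moment R (n - k + i))"
    proof -
      have pull: "r *\<^sub>R (?a k * x) = ?a k * (r *\<^sub>R x)" for r :: real and k and x :: complex by simp
      show ?thesis
        unfolding pull integral_mult_right_zero disc_integral[OF hol] by (simp only: mult.assoc)
    qed
    finally show ?thesis .
  qed
  have "(\<lambda>m. \<Sum>i<Suc j. \<Sum>k\<le>j. ?t i k * disc_moment (real m) (n - k + i))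
      \<longlonglongrightarrow> (\<Sum>i<Suc j. \<Sum>k\<le>j. ?t i k * complex_of_real (fact (n - k + i)))"
    by (intro tendsto_intros disc_moment_limit)
  moreover have "(\<lambda>m. \<Sum>i<Suc j. \<Sum>k\<le>j. ?t i k * disc_moment (real m) (n - k + i))
      \<longlonglongrightarrow> inner_L2 F (polylift j (fock_basis n))"
    using disc_limit[OF L2_integrable_mult[OF F(2) polylift_basis_in_L2[of j n]]]
    unfolding disc inner_L2_def .
  ultimately have "inner_L2 F (polylift j (fock_basis n))
      = (\<Sum>i<Suc j. \<Sum>k\<le>j. ?t i k * complex_of_real (fact (n - k + i)))"
    using LIMSEQ_unique by blast
  also have "\<dots> = (\<Sum>i<Suc j. if i = j then complex_of_real (sqrt (fact j) * sqrt (fact n)) * taylor_coeff (\<psi> j) n else 0)"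
  proof (intro sum.cong refl)
    fix i assume "i \<in> {..<Suc j}"
    then have i: "i \<le> j" by simp
    let ?s = "complex_of_real (sqrt (fact j) * sqrt (fact n))"
    show "(\<Sum>k\<le>j. ?t i k * complex_of_real (fact (n - k + i))) = (if i = j then ?s * taylor_coeff (\<psi> j) n else 0)"
    proof (cases "j \<le> n + i")
      \<comment> \<open>Here n + i < j: for k \<le> n the factor z^(j-k) starts above degree n - k +
        i, and for k > n the coefficient \<open>?a k\<close> is 0.\<close>
      case False
      then have "?t i k = 0" if "k \<le> j" for k
        using that by (auto simp: taylor_coeff_power_mult[OF \<psi>] lift_basis_coeff_def)
      then have "(\<Sum>k\<le>j. ?t i k * complex_of_real (fact (n - k + i))) = 0"
        by (intro sum.neutral ballI) (simp only: atMost_iff mult_zero_left)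
      moreover have "i \<noteq> j" using False by auto
      ultimately show ?thesis by (simp only: if_False)
    next
      case True
      \<comment> \<open>The part of the summand independent of k. The rest comes from (n-k+i)! =
        C(n-k+i, i) i! (n-k)!, whose (n-k)! cancels the denominator of \<open>?a k\<close>; for k >
        n both sides are 0.\<close>
      let ?q = "taylor_coeff (\<psi> i) (n + i - j) * fact n * fact i / ?s"
      have "?t i k * complex_of_real (fact (n - k + i))
          = ?q * ((-1) ^ k * of_nat ((j choose k) * ((n + i - k) choose i)))" if k: "k \<le> j" for k
      proof (cases "k \<le> n")
        case False
        then have "n + i - k < i" using True k by linarith
        with False show ?thesis by (simp add: lift_basis_coeff_def)
      next
        case kn: True
        have e: "n + i - k = n - k + i" using kn by simp
        have "complex_of_nat ((n - k + i) choose i) = fact (n - k + i) / (fact i * fact (n - k))"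
          using binomial_fact[of i "n - k + i", where ?'a = complex] by simp
        then have fc: "complex_of_real (fact (n - k + i)) = of_nat ((n - k + i) choose i) * (fact i * fact (n - k))"
          by simp
        have "j - k \<le> n - k + i" "n - k + i - (j - k) = n + i - j" using True kn k by auto
        then have tc: "taylor_coeff (?\<Psi> i k) (n - k + i) = taylor_coeff (\<psi> i) (n + i - j)"
          by (simp add: taylor_coeff_power_mult[OF \<psi>])
        show ?thesis
          unfolding tc fc e using kn by (simp add: lift_basis_coeff_def)
      qed
      then have "(\<Sum>k\<le>j. ?t i k * complex_of_real (fact (n - k + i)))
          = ?q * (\<Sum>k\<le>j. (-1) ^ k * of_nat ((j choose k) * ((n + i - k) choose i)))"
        by (simp add: sum_distrib_left)
      also have "\<dots> = (if i = j then ?q else 0)"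
        using i alternating_binomial_sum[OF True, of i, where ?'a = complex] by auto
      also have "\<dots> = (if i = j then ?s * taylor_coeff (\<psi> j) n else 0)"
      proof -
        have "fact n * fact j = ?s * ?s"
        proof -
          have "?s * ?s = complex_of_real ((sqrt (fact j) * sqrt (fact j)) * (sqrt (fact n) * sqrt (fact n)))"
            by (simp only: of_real_mult[symmetric] mult_ac)
          then show ?thesis by simp
        qed
        moreover have "?s \<noteq> 0" by simp
        ultimately show ?thesis by (simp add: mult.assoc field_simps del: of_real_mult)
      qed
      finally show ?thesis .
    qed
  qed
  also have "\<dots> = complex_of_real (sqrt (fact j) * sqrt (fact n)) * taylor_coeff (\<psi> j) n" by simp
  finally show ?thesis .
qed

lemma taylor_coeff_divide:
  assumes "f holomorphic_on UNIV"
  shows "taylor_coeff (\<lambda>z. f z / c) n = taylor_coeff f n / c"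
proof -
  have "(deriv ^^ n) (\<lambda>z. f z / c) = (\<lambda>z. (deriv ^^ n) f z / c)"
  proof (induction n)
    case (Suc n)
    have "((\<lambda>z. (deriv ^^ n) f z / c) has_field_derivative (deriv ^^ Suc n) f z / c) (at z)" for z
      by (intro DERIV_cdivide has_field_derivative_higher_deriv[OF assms open_UNIV]) simp
    then show ?case by (auto simp: Suc.IH intro!: DERIV_imp_deriv)
  qed simp
  then show ?thesis by (simp add: taylor_coeff_def)
qed

text \<open>The top coefficient of the lift is g / sqrt(j!), which cancels the prefactor. Square
  integrability is assumed here because its proof for general g rests on the orthonormality drawn
  from this lemma for basis vectors.\<close>

lemma inner_polylift_polylift_basis:
  assumes "g \<in> fock" "polylift j g \<in> L2"
  shows "inner_L2 (polylift j g) (polylift j (fock_basis n)) = inner_L2 g (fock_basis n)"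
proof -
  have "inner_L2 (polylift j g) (polylift j (fock_basis n))
      = complex_of_real (sqrt (fact j) * sqrt (fact n)) * taylor_coeff (lift_coeff j g j) n"
    by (rule inner_polylift_basis[where \<psi> = "lift_coeff j g"])
      (use polylift_eq_sum[OF assms(1), of j] lift_coeff_holomorphic[OF assms(1)] assms(2) in
        \<open>simp_all add: fun_eq_iff del: sum.lessThan_Suc\<close>)
  then show ?thesis
    by (simp add: lift_coeff_top taylor_coeff_divide fock_D(2)[OF assms(1)] inner_fock_basis[OF assms(1)])
qed

section \<open>Expansions, isometry and the adjoint of the lift\<close>

interpretation lift: orthonormal_L2 "\<lambda>n. polylift j (fock_basis n)" for j
proof
  show "polylift j (fock_basis n) \<in> L2" for n by (rule polylift_basis_in_L2)
  show "inner_L2 (polylift j (fock_basis m)) (polylift j (fock_basis n)) = (if m = n then 1 else 0)" for m n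
    by (simp add: inner_polylift_polylift_basis fock_basis_in_fock polylift_basis_in_L2 fock.orthonormal)
qed

interpretation U: orthonormal_L2 "\<lambda>n. U_op z (fock_basis n)" for z
  by standard (simp_all add: inner_U_op fock_basis_in_fock fock.orthonormal fock_D(1)[OF U_op_fock])

lemma summable_fock_coeffs: "g \<in> fock \<Longrightarrow> summable (\<lambda>n. (cmod (inner_L2 g (fock_basis n)))\<^sup>2)"
  by (intro fock.Bessel fock_D)

text \<open>Fix z: in the variable w the expansion of U_z g runs along the orthonormal U_z e_n, so
  \<open>Riesz_Fischer\<close> allows the inner product with e_j to be taken term by term. The
  result is pointwise in z.\<close>

lemma polylift_expansion:
  assumes "g \<in> fock"
  shows "(\<lambda>n. inner_L2 g (fock_basis n) * polylift j (fock_basis n) z) sums polylift j g z"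
proof -
  let ?c = "\<lambda>n. inner_L2 g (fock_basis n)"
  have "(\<lambda>n. ?c n * U_op z (fock_basis n) w) sums U_op z g w" for w
    using sums_mult2[OF fock_expansion[OF assms, of "z - w"], of "kern z w"]
    by (simp add: U_op_def mult.assoc)
  from U.Riesz_Fischer(2)[OF summable_fock_coeffs[OF assms] this, of "fock_basis j"]
  have "(\<lambda>n. cnj (?c n) * inner_L2 (fock_basis j) (U_op z (fock_basis n))) sums inner_L2 (fock_basis j) (U_op z g)"
    using fock.in_L2 by blast
  \<comment> \<open>\<open>Riesz_Fischer\<close> places the series in the second argument;
    conjugation moves it to the first.\<close>
  then have "(\<lambda>n. cnj (cnj (?c n) * inner_L2 (fock_basis j) (U_op z (fock_basis n)))) sums cnj (inner_L2 (fock_basis j) (U_op z g))"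
    by (simp only: sums_cnj)
  then have "(\<lambda>n. ?c n * inner_L2 (U_op z (fock_basis n)) (fock_basis j)) sums inner_L2 (U_op z g) (fock_basis j)"
    by (simp add: inner_L2_cnj[symmetric])
  from sums_mult[OF this, of "exp (of_real ((cmod z)\<^sup>2 / 2))"] show ?thesis
    by (simp add: polylift_def mult_ac)
qed

lemma polylift_in_L2: "g \<in> fock \<Longrightarrow> polylift j g \<in> L2"
  by (rule lift.Riesz_Fischer(1)[OF summable_fock_coeffs polylift_expansion])

lemma inner_with_polylift:
  assumes "h \<in> fock" "\<phi> \<in> L2"
  shows "(\<lambda>n. cnj (inner_L2 h (fock_basis n)) * inner_L2 \<phi> (polylift j (fock_basis n))) sums inner_L2 \<phi> (polylift j h)"
  by (rule lift.Riesz_Fischer(2)[OF summable_fock_coeffs polylift_expansion]) (use assms in auto)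

lemma inner_with_fock:
  assumes "h \<in> fock" "\<phi> \<in> L2"
  shows "(\<lambda>n. cnj (inner_L2 h (fock_basis n)) * inner_L2 \<phi> (fock_basis n)) sums inner_L2 \<phi> h"
  by (rule fock.Riesz_Fischer(2)[OF summable_fock_coeffs fock_expansion]) (use assms in auto)

lemma inner_polylift:
  assumes "g \<in> fock" "h \<in> fock"
  shows "inner_L2 (polylift j g) (polylift j h) = inner_L2 g h"
  using inner_with_polylift[OF assms(2) polylift_in_L2[OF assms(1)], of j j]
    inner_with_fock[OF assms(2) fock_D(1)[OF assms(1)]]
  by (simp add: inner_polylift_polylift_basis assms polylift_in_L2 sums_unique2)

lemma fock_eqI:
  assumes "f \<in> fock" "g \<in> fock" "\<And>n. inner_L2 f (fock_basis n) = inner_L2 g (fock_basis n)"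
  shows "f = g"
  using fock_expansion[OF assms(1)] fock_expansion[OF assms(2)] assms(3) sums_unique2 by fastforce

text \<open>Since |c_n e_n(z)| \<le> |c_n|^2 + |z|^(2n)/n!, the series converges everywhere and
  defines an entire function. It supplies witnesses for the \<open>THE\<close> descriptions.\<close>

lemma fock_synthesis:
  assumes c: "summable (\<lambda>n. (cmod (c n))\<^sup>2)"
  obtains u where "u \<in> fock" "\<And>n. inner_L2 u (fock_basis n) = c n"
proof -
  have "summable (\<lambda>n. c n * fock_basis n z)" for z
  proof (rule summable_comparison_test'[where N = 0])
    have "summable (\<lambda>n. ((cmod z)\<^sup>2) ^ n / fact n)"
      using summable_exp[of "(cmod z)\<^sup>2"] by (simp add: field_simps)
    then show "summable (\<lambda>n. (cmod (c n))\<^sup>2 + ((cmod z)\<^sup>2) ^ n / fact n)" by (intro summable_add c)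
    show "norm (c n * fock_basis n z) \<le> (cmod (c n))\<^sup>2 + ((cmod z)\<^sup>2) ^ n / fact n" for n
    proof -
      have "x * y \<le> x\<^sup>2 + y\<^sup>2" for x y :: real
        using zero_le_power2[of "x - y"] zero_le_power2[of "x + y"] by (simp add: power2_diff power2_sum)
      from this[of "cmod (c n)" "cmod (fock_basis n z)"] show ?thesis
        by (simp add: norm_mult fock_basis_def norm_divide norm_power power_divide power_mult[symmetric] mult.commute)
    qed
  qed
  then have S: "(\<lambda>n. c n * fock_basis n z) sums (\<Sum>n. c n * fock_basis n z)" for z
    by (rule summable_sums)
  define u where "u z = (\<Sum>n. c n * fock_basis n z)" for z
  have "u holomorphic_on ball 0 r" for r
    by (rule power_series_holomorphic[of 0 r "\<lambda>n. c n / complex_of_real (sqrt (fact n))"])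
      (use S in \<open>auto simp: u_def fock_basis_def\<close>)
  then have "u holomorphic_on (\<Union>n::nat. ball 0 (real n))"
    by (intro holomorphic_on_UN_open) auto
  moreover have "(\<Union>n::nat. ball 0 (real n)) = (UNIV :: complex set)"
    by (auto simp: reals_Archimedean2)
  ultimately have hol: "u holomorphic_on UNIV" by simp
  note RF = fock.Riesz_Fischer[OF c, of u, unfolded u_def, OF S, folded u_def]
  have "inner_L2 u (fock_basis m) = c m" for m
  proof -
    have "(\<lambda>n. cnj (c n) * inner_L2 (fock_basis m) (fock_basis n)) sums inner_L2 (fock_basis m) u"
      by (rule RF(2)) (rule fock.in_L2)
    moreover have "(\<lambda>n. cnj (c n) * inner_L2 (fock_basis m) (fock_basis n)) = (\<lambda>n. if n = m then cnj (c n) else 0)"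
      by (auto simp: fock.orthonormal)
    ultimately have "inner_L2 (fock_basis m) u = cnj (c m)"
      using sums_single[of m "\<lambda>n. cnj (c n)"] sums_unique2 by metis
    then show ?thesis by (subst inner_L2_cnj) simp
  qed
  with RF(1) hol show thesis by (intro that[of u]) (auto simp: fock_def)
qed

text \<open>Bessel's inequality for the lifted basis makes the prescribed coefficients of u
  square-summable; both sides then have the same expansion along the coefficients of h.\<close>

lemma polylift_adjoint:
  assumes "\<phi> \<in> L2"
  obtains u where "u \<in> fock" "\<And>h. h \<in> fock \<Longrightarrow> inner_L2 \<phi> (polylift j h) = inner_L2 u h"
proof -
  obtain u where u: "u \<in> fock" "\<And>n. inner_L2 u (fock_basis n) = inner_L2 \<phi> (polylift j (fock_basis n))"
    using fock_synthesis[OF lift.Bessel[OF assms]] by blast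
  have "inner_L2 \<phi> (polylift j h) = inner_L2 u h" if "h \<in> fock" for h
    using inner_with_polylift[OF that assms, of j] inner_with_fock[OF that fock_D(1)[OF u(1)]]
    by (simp add: u(2) sums_unique2)
  with u(1) show thesis by (rule that)
qed

lemma polylift_orthogonal:
  assumes "g \<in> fock" "h \<in> poly_fock j"
  shows "inner_L2 (polylift j g) h = 0"
proof -
  have h: "h \<in> L2" using assms(2) by (simp add: poly_fock_iff)
  obtain \<psi> where \<psi>: "\<And>i. \<psi> i holomorphic_on UNIV" "h = (\<lambda>z. \<Sum>i<j. cnj z ^ i * \<psi> i z)"
    using assms(2) by (auto simp: poly_fock_iff polyanalytic_def)
  \<comment> \<open>An element of F_j^2 is read as one of order j + 1 with top coefficient
    0.\<close>
  let ?\<psi> = "\<psi>(j := (\<lambda>z. 0))"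
  have "inner_L2 h (polylift j (fock_basis n)) = 0" for n
  proof -
    have "inner_L2 h (polylift j (fock_basis n)) = complex_of_real (sqrt (fact j) * sqrt (fact n)) * taylor_coeff (?\<psi> j) n"
      by (rule inner_polylift_basis) (use \<psi> h in auto)
    then show ?thesis by (simp add: taylor_coeff_const)
  qed
  then have "inner_L2 h (polylift j g) = 0"
    using inner_with_polylift[OF assms(1) h, of j] sums_unique2[OF _ sums_zero] by simp
  then show ?thesis by (subst inner_L2_cnj) simp
qed

lemma polyanalytic_diff:
  assumes "polyanalytic k f" "polyanalytic k g"
  shows "polyanalytic k (\<lambda>z. f z - g z)"
proof -
  obtain \<phi> where \<phi>: "\<And>i. \<phi> i holomorphic_on UNIV" "f = (\<lambda>z. \<Sum>i<k. cnj z ^ i * \<phi> i z)"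
    using assms(1) by (auto simp: polyanalytic_def)
  obtain \<psi> where \<psi>: "\<And>i. \<psi> i holomorphic_on UNIV" "g = (\<lambda>z. \<Sum>i<k. cnj z ^ i * \<psi> i z)"
    using assms(2) by (auto simp: polyanalytic_def)
  show ?thesis
    unfolding polyanalytic_def
    by (rule exI[of _ "\<lambda>i z. \<phi> i z - \<psi> i z"])
      (auto simp: \<phi>(2) \<psi>(2) sum_subtractf right_diff_distrib intro!: holomorphic_intros \<phi>(1) \<psi>(1))
qed

lemma polylift_in_poly_fock: "g \<in> fock \<Longrightarrow> polylift j g \<in> poly_fock (Suc j)"
  by (simp add: poly_fock_iff polylift_in_L2 polyanalytic_polylift)

lemma polylift_image: "polylift j ` fock = true_poly_fock (Suc j)"
proof (intro equalityI subsetI)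
  fix F assume "F \<in> polylift j ` fock"
  then show "F \<in> true_poly_fock (Suc j)"
    by (auto simp: true_poly_fock_def polylift_in_poly_fock polylift_orthogonal)
next
  fix F assume "F \<in> true_poly_fock (Suc j)"
  then have F: "F \<in> L2" "polyanalytic (Suc j) F" "\<And>h. h \<in> poly_fock j \<Longrightarrow> inner_L2 F h = 0"
    by (auto simp: true_poly_fock_def poly_fock_iff)
  obtain u where u: "u \<in> fock" "\<And>h. h \<in> fock \<Longrightarrow> inner_L2 F (polylift j h) = inner_L2 u h"
    using polylift_adjoint[OF F(1)] by metis
  define H where "H z = F z - polylift j u z" for z
  have H: "H \<in> L2" "polyanalytic (Suc j) H"
    unfolding H_def[abs_def] using F u by (auto intro!: L2_diff polyanalytic_diff polylift_in_L2 polyanalytic_polylift)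
  obtain \<psi> where \<psi>: "\<And>i. \<psi> i holomorphic_on UNIV" "H = (\<lambda>z. \<Sum>i<Suc j. cnj z ^ i * \<psi> i z)"
    using H(2) by (auto simp: polyanalytic_def)
  have "taylor_coeff (\<psi> j) n = 0" for n
  proof -
    have "inner_L2 H (polylift j (fock_basis n)) = 0"
      unfolding H_def[abs_def] using F(1) u fock_basis_in_fock[of n]
      by (simp add: inner_L2_diff_left polylift_in_L2 inner_polylift)
    then show ?thesis using inner_polylift_basis[OF \<psi> H(1), of n] by simp
  qed
  then have "\<psi> j z = 0" for z by (rule taylor_coeff_eq_0[OF \<psi>(1)])
  then have "polyanalytic j H"
    unfolding polyanalytic_def using \<psi> by auto
  then have "H \<in> poly_fock j" using H(1) by (simp add: poly_fock_iff)
  \<comment> \<open>H lies in F_j^2 and is the difference of two functions orthogonal to F_j^2: F by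
    assumption, the lift of u by \<open>polylift_orthogonal\<close>.\<close>
  then have "inner_L2 H H = 0"
    using F(3) polylift_orthogonal[OF u(1)] inner_L2_diff_left[OF F(1) polylift_in_L2[OF u(1)] H(1)]
    by (simp add: H_def[abs_def])
  then have "norm2_L2 H = 0" by (simp add: inner_L2_self)
  then have "H z = 0" for z
    using continuous_norm2_L2_eq_0[OF polyanalytic_continuous[OF H(2)] H(1)] by blast
  then have "F = polylift j u" by (auto simp: H_def)
  with u(1) show "F \<in> polylift j ` fock" by blast
qed

lemma unitary_polylift: "unitary_between fock (true_poly_fock (Suc j)) (polylift j)"
proof -
  have "inj_on (polylift j) fock"
  proof (rule inj_onI)
    fix f g assume fg: "f \<in> fock" "g \<in> fock" "polylift j f = polylift j g"
    show "f = g"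
    proof (rule fock_eqI[OF fg(1,2)])
      fix n
      show "inner_L2 f (fock_basis n) = inner_L2 g (fock_basis n)"
        using inner_polylift[OF fg(1) fock_basis_in_fock, of j n] inner_polylift[OF fg(2) fock_basis_in_fock, of j n] fg(3)
        by simp
    qed
  qed
  then show ?thesis
    by (auto simp: unitary_between_def bij_betw_def polylift_image polylift_lincomb inner_polylift)
qed

section \<open>Toeplitz operators transported along the lift\<close>

lemma Linfty_mult_L2:
  assumes "f \<in> Linfty" "g \<in> L2"
  shows "(\<lambda>z. f z * g z) \<in> L2"
proof -
  obtain C where C: "AE z in lebesgue. cmod (f z) \<le> C" and f: "f \<in> borel_measurable lebesgue"
    using assms(1) by (auto simp: Linfty_def)
  have "AE z in gaussian. cmod (f z) \<le> C"
    unfolding gaussian_def by (subst AE_density) (use C in auto)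
  then show ?thesis
    using f by (intro L2_bounded_mult[OF assms(2)]) (auto simp: measurable_cong_sets[OF sets_gaussian refl])
qed

text \<open>Every candidate for the projection is the lift of some v. Testing against lifts turns
  its defining condition, by isometry, into equality of v and u on all of the Fock space.\<close>

lemma toeplitz_polylift:
  assumes f: "f \<in> Linfty" and g: "g \<in> fock" and u: "u \<in> fock"
    and adj: "\<And>h. h \<in> fock \<Longrightarrow> inner_L2 (\<lambda>z. f z * polylift j g z) (polylift j h) = inner_L2 u h"
  shows "toeplitz (Suc j) f (polylift j g) = polylift j u"
proof -
  let ?\<phi> = "\<lambda>z. f z * polylift j g z"
  have \<phi>: "?\<phi> \<in> L2" by (rule Linfty_mult_L2[OF f polylift_in_L2[OF g]])
  have iff: "(\<forall>h\<in>fock. inner_L2 (\<lambda>z. ?\<phi> z - polylift j v z) (polylift j h) = 0) \<longleftrightarrow> v = u" if v: "v \<in> fock" for v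
  proof -
    have "inner_L2 (\<lambda>z. ?\<phi> z - polylift j v z) (polylift j h) = inner_L2 u h - inner_L2 v h" if "h \<in> fock" for h
      using inner_L2_diff_left[OF \<phi> polylift_in_L2[OF v] polylift_in_L2[OF that]] adj[OF that] inner_polylift[OF v that]
      by simp
    then show ?thesis using fock_eqI[OF v u] fock_basis_in_fock by auto
  qed
  show ?thesis
    unfolding toeplitz_def orth_proj_def polylift_image[symmetric]
    by (rule the_equality) (use iff u in auto)
qed

lemma adj_op_polylift:
  assumes "u \<in> fock"
  shows "adj_op fock (polylift j) (polylift j u) = u"
  unfolding adj_op_def
proof (rule the_equality)
  show "u \<in> fock \<and> (\<forall>f\<in>fock. inner_L2 (polylift j f) (polylift j u) = inner_L2 f u)"
    using assms by (simp add: inner_polylift)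
  fix v assume v: "v \<in> fock \<and> (\<forall>f\<in>fock. inner_L2 (polylift j f) (polylift j u) = inner_L2 f v)"
  then have "inner_L2 h v = inner_L2 h u" if "h \<in> fock" for h
    using that assms by (simp add: inner_polylift)
  then show "v = u"
    using v assms by (intro fock_eqI) (auto simp: inner_L2_cnj[of _ "fock_basis _"] fock_basis_in_fock)
qed

lemma toeplitz_type_form:
  assumes f: "f \<in> Linfty" and g: "g \<in> fock" and h: "h \<in> fock"
  shows "complex_of_real (1 / pi) * (LINT z|lebesgue. f z * inner_L2 (U_op z g) (fock_basis j)
      * inner_L2 (fock_basis j) (U_op z h)) = inner_L2 (\<lambda>z. f z * polylift j g z) (polylift j h)"
proof -
  have m: "polylift j k \<in> borel_measurable lebesgue" if "k \<in> fock" for k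
    using L2_D(1)[OF polylift_in_L2[OF that]] by (simp add: measurable_cong_sets[OF sets_gaussian refl])
  have [measurable]: "f \<in> borel_measurable lebesgue" using f by (simp add: Linfty_def)
  note [measurable] = m[OF g] m[OF h]
  have "inner_L2 (\<lambda>z. f z * polylift j g z) (polylift j h)
      = (LINT z|lebesgue. (exp (- (cmod z)\<^sup>2) / pi) *\<^sub>R (f z * polylift j g z * cnj (polylift j h z)))"
    unfolding inner_L2_def by (rule integral_gaussian) measurable
  also have "\<dots> = (LINT z|lebesgue. complex_of_real (1 / pi) * (f z * inner_L2 (U_op z g) (fock_basis j)
      * inner_L2 (fock_basis j) (U_op z h)))"
  proof (intro Bochner_Integration.integral_cong refl)
    fix z
    let ?e = "exp ((cmod z)\<^sup>2 / 2)"
    have "exp (- (cmod z)\<^sup>2) * (?e * ?e) = 1" by (simp flip: exp_add)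
    then have e: "complex_of_real (exp (- (cmod z)\<^sup>2)) * (complex_of_real ?e * complex_of_real ?e) = 1"
      by (metis of_real_1 of_real_mult)
    have p: "polylift j k z = complex_of_real ?e * inner_L2 (U_op z k) (fock_basis j)" for k
      unfolding polylift_def exp_of_real ..
    have "(exp (- (cmod z)\<^sup>2) / pi) *\<^sub>R (f z * polylift j g z * cnj (polylift j h z))
        = (complex_of_real (exp (- (cmod z)\<^sup>2)) * (complex_of_real ?e * complex_of_real ?e)) *
          (complex_of_real (1 / pi) * (f z * inner_L2 (U_op z g) (fock_basis j) * cnj (inner_L2 (U_op z h) (fock_basis j))))"
      unfolding p by (simp add: scaleR_conv_of_real mult_ac)
    then show "(exp (- (cmod z)\<^sup>2) / pi) *\<^sub>R (f z * polylift j g z * cnj (polylift j h z))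
        = complex_of_real (1 / pi) * (f z * inner_L2 (U_op z g) (fock_basis j) * inner_L2 (fock_basis j) (U_op z h))"
      unfolding e by (simp add: inner_L2_cnj[symmetric])
  qed
  finally show ?thesis by simp
qed

text \<open>Both sides equal the vector u representing h \<mapsto> <f A g, A h>: the left by the
  weak definition, the right because the projection of f A g is A u and the adjoint undoes
  A.\<close>

lemma toeplitz_type_eq:
  assumes f: "f \<in> Linfty" and g: "g \<in> fock"
  shows "toeplitz_type j f g = adj_op fock (polylift j) (toeplitz (Suc j) f (polylift j g))"
proof -
  let ?\<phi> = "\<lambda>z. f z * polylift j g z"
  have \<phi>: "?\<phi> \<in> L2" by (rule Linfty_mult_L2[OF f polylift_in_L2[OF g]])
  obtain u where u: "u \<in> fock" "\<And>h. h \<in> fock \<Longrightarrow> inner_L2 ?\<phi> (polylift j h) = inner_L2 u h"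
    using polylift_adjoint[OF \<phi>] by metis
  have "toeplitz_type j f g = u"
    unfolding toeplitz_type_def
  proof (rule the_equality)
    show "u \<in> fock \<and> (\<forall>h\<in>fock. inner_L2 u h = complex_of_real (1 / pi) *
        (LINT z|lebesgue. f z * inner_L2 (U_op z g) (fock_basis j) * inner_L2 (fock_basis j) (U_op z h)))"
      using u by (auto simp only: toeplitz_type_form[OF f g])
    fix v assume "v \<in> fock \<and> (\<forall>h\<in>fock. inner_L2 v h = complex_of_real (1 / pi) *
        (LINT z|lebesgue. f z * inner_L2 (U_op z g) (fock_basis j) * inner_L2 (fock_basis j) (U_op z h)))"
    then show "v = u"
      using u by (intro fock_eqI) (auto simp only: toeplitz_type_form[OF f g] fock_basis_in_fock)
  qed
  then show ?thesis
    by (simp add: toeplitz_polylift[OF f g u] adj_op_polylift[OF u(1)])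
qed

theorem mainTheorem9:
  fixes j :: nat
  shows "(\<exists>A. unitary_between fock (true_poly_fock (j + 1)) A \<and>
            (\<forall>z. \<forall>g\<in>fock. weyl z (A g) = A (weyl z g)) \<and>
            (\<forall>f\<in>Linfty. \<forall>g\<in>fock.
               toeplitz_type j f g = adj_op fock A (toeplitz (j + 1) f (A g)))) \<and>
         (\<forall>f\<in>Linfty. unitarily_equivalent fock (true_poly_fock (j + 1))
            (toeplitz_type j f) (toeplitz (j + 1) f))"
  using unitary_polylift[of j] polylift_weyl[of _ j] toeplitz_type_eq[of _ _ j]
  unfolding unitarily_equivalent_def Suc_eq_plus1 by blast

end
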